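(* Let $t \ge 3$ and $n \ge 1$ be integers, and let $I \subset [t]^n$ be an independent set of $K_t^n$ with $\epsilon := 1 - t\mu(I) < 1 - \frac{3}{t} + \frac{2}{t^2}$ (equivalently, $\mu(I) > \frac{3t-2}{t^3}$). Then there exists an independent set $J \subset [t]^n$ of $K_t^n$ of maximum size (so $\mu(J)=1/t$) such that \[ \mu(I \setminus J) \le 4\epsilon^{\eta(t)}, \qquad \text{where } \eta(t) = \frac{\log t}{\log t - \log(t-1)}. \]
   Context: $K_t^n$ is the graph with vertex set $[t]^n = \{1,\dots,t\}^n$ in which $x,y$ are adjacent iff $x_i \neq y_i$ for all $i \in [n]$. For $S \subseteq [t]^n$, $\mu(S) := |S|/t^n$. $\log$ is the natural logarithm. *)

theory Defs
  imports Complex_Main "HOL-Library.FuncSet"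
begin

text \<open>Points of \<open>[t]^n\<close> are functions on the index set \<open>{1..n}\<close>, extended by \<open>undefined\<close> outside it
  (\<open>PiE\<close>), so that \<open>[t]^n\<close> has exactly \<open>t ^ n\<close> elements.\<close>

definition cube :: "nat \<Rightarrow> nat \<Rightarrow> (nat \<Rightarrow> nat) set" where
  "cube t n = {1..n} \<rightarrow>\<^sub>E {1..t}"

definition K_adj :: "nat \<Rightarrow> nat \<Rightarrow> (nat \<Rightarrow> nat) \<Rightarrow> (nat \<Rightarrow> nat) \<Rightarrow> bool" where
  "K_adj t n x y \<longleftrightarrow> x \<in> cube t n \<and> y \<in> cube t n \<and> (\<forall>i\<in>{1..n}. x i \<noteq> y i)"

definition K_indep :: "nat \<Rightarrow> nat \<Rightarrow> (nat \<Rightarrow> nat) set \<Rightarrow> bool" where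
  "K_indep t n S \<longleftrightarrow> S \<subseteq> cube t n \<and> (\<forall>x\<in>S. \<forall>y\<in>S. \<not> K_adj t n x y)"

definition K_max_indep :: "nat \<Rightarrow> nat \<Rightarrow> (nat \<Rightarrow> nat) set \<Rightarrow> bool" where
  "K_max_indep t n J \<longleftrightarrow> K_indep t n J \<and> (\<forall>S. K_indep t n S \<longrightarrow> card S \<le> card J)"

definition mu :: "nat \<Rightarrow> nat \<Rightarrow> (nat \<Rightarrow> nat) set \<Rightarrow> real" where
  "mu t n S = real (card S) / real t ^ n"

definition eta :: "nat \<Rightarrow> real" where
  "eta t = ln (real t) / (ln (real t) - ln (real t - 1))"

end

theory Submission
  imports Defs "HOL-Analysis.Convex" "HOL-Combinatorics.Transposition"
begin

text \<open>Write \<open>p = 1/t\<close>, \<open>q = 1 - p\<close>, so that \<open>q powr \<eta> = p\<close>, and let \<open>\<alpha>\<close> be the density of \<open>I\<close> inside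
  \<open>{x. x i = j}\<close>. Every point of another slice of \<open>I\<close> in direction \<open>i\<close> agrees somewhere with every
  point of this one, so an isoperimetric inequality bounds the density of that slice by
  \<open>(1 - \<alpha>) powr \<eta>\<close>, and the density of \<open>I\<close> is at most \<open>p * \<alpha> + q * (1 - \<alpha>) powr \<eta>\<close>. This is convex
  in \<open>\<alpha>\<close> and equals \<open>3p^2 - 2p^3\<close> at both \<open>1 - q^2\<close> and \<open>1 - q^3\<close>, so the hypothesis leaves a gap:
  either \<open>\<alpha> < 1 - q^2\<close> or \<open>\<alpha> > 1 - q^3\<close>. In the second case the same bound gives the conclusion, with
  \<open>J = {x. x i = j}\<close>.

  It remains to see that some \<open>\<alpha>\<close> lies above the gap. The set \<open>I\<close> is deformed, without decreasing its
  measure, in steps so small that no \<open>\<alpha>\<close> can jump over the gap. Replacing coordinate values by \<open>1\<close>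
  makes the supports \<open>{i. x i = 1}\<close> an intersecting family, which is then extended to a maximal one.
  Shifts of a coordinate \<open>m\<close>, together with exchanges of a large minimal member by its
  complement, make the family independent of \<open>m\<close>. Inductively one is left with at most three
  coordinates, where the measure of a family without singletons is at most \<open>3p^2 - 2p^3\<close>.\<close>

section \<open>Maximal intersecting families\<close>

definition maximal_intersecting :: "'a set \<Rightarrow> 'a set set \<Rightarrow> bool" where
  "maximal_intersecting X F \<longleftrightarrow>
    F \<subseteq> Pow X \<and> (\<forall>A\<in>F. \<forall>B\<in>F. A \<inter> B \<noteq> {}) \<and> (\<forall>A. A \<subseteq> X \<longrightarrow> A \<in> F \<or> X - A \<in> F)"

lemma maximal_intersecting_subset: "maximal_intersecting X F \<Longrightarrow> A \<in> F \<Longrightarrow> A \<subseteq> X"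
  unfolding maximal_intersecting_def by blast

lemma maximal_intersecting_meet: "maximal_intersecting X F \<Longrightarrow> A \<in> F \<Longrightarrow> B \<in> F \<Longrightarrow> A \<inter> B \<noteq> {}"
  unfolding maximal_intersecting_def by blast

lemma maximal_intersecting_Diff_iff:
  assumes "maximal_intersecting X F" "A \<subseteq> X"
  shows "X - A \<in> F \<longleftrightarrow> A \<notin> F"
  using assms maximal_intersecting_meet[OF assms(1), of A "X - A"]
  unfolding maximal_intersecting_def by blast

definition upward_closed :: "'a set \<Rightarrow> 'a set set \<Rightarrow> bool" where
  "upward_closed X F \<longleftrightarrow> (\<forall>A B. A \<in> F \<longrightarrow> A \<subseteq> B \<longrightarrow> B \<subseteq> X \<longrightarrow> B \<in> F)"

lemma upward_closedD: "upward_closed X F \<Longrightarrow> A \<in> F \<Longrightarrow> A \<subseteq> B \<Longrightarrow> B \<subseteq> X \<Longrightarrow> B \<in> F"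
  unfolding upward_closed_def by blast

lemma maximal_intersecting_upward_closed:
  assumes "maximal_intersecting X F"
  shows "upward_closed X F"
  unfolding upward_closed_def
proof (intro allI impI, rule ccontr)
  fix A B assume "A \<in> F" "A \<subseteq> B" "B \<subseteq> X" "B \<notin> F"
  then show False
    using maximal_intersecting_Diff_iff[OF assms, of B] maximal_intersecting_meet[OF assms, of A "X - B"]
    by blast
qed

lemma maximal_intersectingI:
  assumes X: "X \<noteq> {}" and sub: "G \<subseteq> Pow X" and meet: "\<And>A B. A \<in> G \<Longrightarrow> B \<in> G \<Longrightarrow> A \<inter> B \<noteq> {}"
    and saturated: "\<And>A. A \<subseteq> X \<Longrightarrow> A \<noteq> {} \<Longrightarrow> A \<notin> G \<Longrightarrow> \<exists>B\<in>G. A \<inter> B = {}"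
  shows "maximal_intersecting X G"
proof -
  have "X \<in> G"
  proof (rule ccontr)
    assume "X \<notin> G"
    then obtain B where "B \<in> G" "X \<inter> B = {}"
      using saturated[of X] X by blast
    then show False
      using sub meet[of B B] by blast
  qed
  have "A \<in> G \<or> X - A \<in> G" if A: "A \<subseteq> X" for A
  proof (rule ccontr)
    assume no: "\<not> ?thesis"
    then have "A \<noteq> {}" "X - A \<noteq> {}"
      using \<open>X \<in> G\<close> A by auto
    then obtain B C where "B \<in> G" "A \<inter> B = {}" "C \<in> G" "(X - A) \<inter> C = {}"
      using saturated[of A] saturated[of "X - A"] A no by blast
    then show False
      using meet[of B C] sub by blast
  qed
  then show ?thesis
    unfolding maximal_intersecting_def using sub meet by blast
qed

lemma extend_to_maximal_intersecting:
  assumes X: "finite X" "X \<noteq> {}" and F: "F \<subseteq> Pow X" "\<And>A B. A \<in> F \<Longrightarrow> B \<in> F \<Longrightarrow> A \<inter> B \<noteq> {}"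
  obtains G where "maximal_intersecting X G" "F \<subseteq> G"
proof -
  define \<G> where "\<G> = {G. G \<subseteq> Pow X \<and> (\<forall>A\<in>G. \<forall>B\<in>G. A \<inter> B \<noteq> {})}"
  have "finite \<G>"
    using X by (intro finite_subset[of \<G> "Pow (Pow X)"]) (auto simp: \<G>_def)
  moreover have "F \<in> \<G>"
    using F by (auto simp: \<G>_def)
  ultimately obtain G where G: "G \<in> \<G>" "F \<subseteq> G" and max: "\<And>H. H \<in> \<G> \<Longrightarrow> G \<subseteq> H \<Longrightarrow> G = H"
    using finite_has_maximal2[of \<G> F] by metis
  have "maximal_intersecting X G"
  proof (rule maximal_intersectingI[OF X(2)])
    fix A assume A: "A \<subseteq> X" "A \<noteq> {}" "A \<notin> G"
    then have "insert A G \<notin> \<G>"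
      using max[of "insert A G"] by blast
    then show "\<exists>B\<in>G. A \<inter> B = {}"
      using A G(1) by (auto simp: \<G>_def Int_commute)
  qed (use G(1) in \<open>auto simp: \<G>_def\<close>)
  then show ?thesis
    using that G(2) by blast
qed

definition minimal_member :: "'a set set \<Rightarrow> 'a set \<Rightarrow> bool" where
  "minimal_member F M \<longleftrightarrow> M \<in> F \<and> (\<forall>z\<in>M. M - {z} \<notin> F)"

lemma not_member_below_minimal:
  assumes F: "maximal_intersecting X F" and M: "minimal_member F M" and "A \<subset> M"
  shows "A \<notin> F"
proof
  assume A: "A \<in> F"
  obtain z where z: "z \<in> M" "A \<subseteq> M - {z}"
    using assms(3) by blast
  moreover have "M - {z} \<subseteq> X"
    using M maximal_intersecting_subset[OF F] unfolding minimal_member_def by blast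
  ultimately have "M - {z} \<in> F"
    using upward_closedD[OF maximal_intersecting_upward_closed[OF F] A] by blast
  with M z(1) show False
    by (simp add: minimal_member_def)
qed

lemma minimal_member_neq_ground:
  assumes F: "maximal_intersecting X F" and M: "minimal_member F M" and X: "2 \<le> card X"
  shows "M \<noteq> X"
proof
  assume "M = X"
  then have singletons: "{z} \<in> F" if "z \<in> X" for z
    using that M maximal_intersecting_Diff_iff[OF F, of "{z}"] by (auto simp: minimal_member_def)
  obtain y z where "y \<in> X" "z \<in> X" "y \<noteq> z"
    using X by (metis card_2_iff' obtain_subset_with_card_n subsetD)
  then show False
    using singletons[of y] singletons[of z] maximal_intersecting_meet[OF F, of "{y}" "{z}"] by simp
qed

definition exchange :: "'a set \<Rightarrow> 'a set \<Rightarrow> 'a set set \<Rightarrow> 'a set set" where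
  "exchange X M F = insert (X - M) (F - {M})"

lemma maximal_intersecting_exchange:
  assumes F: "maximal_intersecting X F" and M: "minimal_member F M" "M \<noteq> X"
  shows "maximal_intersecting X (exchange X M F)"
proof -
  have MX: "M \<in> F" "M \<subseteq> X"
    using M maximal_intersecting_subset[OF F] by (auto simp: minimal_member_def)
  have meet_complement: "A \<inter> (X - M) \<noteq> {}" if "A \<in> exchange X M F" for A
  proof (cases "A = X - M")
    case True
    then show ?thesis
      using MX M(2) by auto
  next
    case False
    then have "A \<in> F" "A \<noteq> M"
      using that by (auto simp: exchange_def)
    then show ?thesis
      using not_member_below_minimal[OF F M(1), of A] maximal_intersecting_subset[OF F, of A] by blast
  qed
  have "A \<inter> B \<noteq> {}" if "A \<in> exchange X M F" "B \<in> exchange X M F" for A B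
    using that meet_complement maximal_intersecting_meet[OF F]
    by (metis DiffD1 Int_commute exchange_def insertE)
  moreover have "A \<in> exchange X M F \<or> X - A \<in> exchange X M F" if "A \<subseteq> X" for A
    using that MX maximal_intersecting_Diff_iff[OF F that] by (auto simp: exchange_def double_diff)
  moreover have "exchange X M F \<subseteq> Pow X"
    using maximal_intersecting_subset[OF F] by (auto simp: exchange_def)
  ultimately show ?thesis
    unfolding maximal_intersecting_def by blast
qed

text \<open>A set containing both or neither of \<open>i\<close> and \<open>m\<close> is fixed by the transposition, so its membership
  does not change.\<close>

definition shift :: "'a \<Rightarrow> 'a \<Rightarrow> 'a set set \<Rightarrow> 'a set set" where
  "shift m i F = {A. if i \<in> A then A \<in> F \<or> transpose i m ` A \<in> F else A \<in> F \<and> transpose i m ` A \<in> F}"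

lemma maximal_intersecting_shift:
  assumes F: "maximal_intersecting X F" and "i \<in> X" "m \<in> X"
  shows "maximal_intersecting X (shift m i F)"
proof -
  let ?\<sigma> = "\<lambda>A. transpose i m ` A"
  have \<sigma>: "?\<sigma> (?\<sigma> A) = A" "?\<sigma> X = X" "?\<sigma> (X - A) = X - ?\<sigma> A" "?\<sigma> A \<inter> ?\<sigma> B = ?\<sigma> (A \<inter> B)" for A B
    using assms by (simp_all add: image_image image_set_diff image_Int)
  have \<sigma>_sub: "?\<sigma> A \<subseteq> X" if "A \<subseteq> X" for A
    using that \<sigma>(2) by (metis image_mono)
  have sub: "A \<subseteq> X" if "A \<in> shift m i F" for A
  proof -
    have "A \<in> F \<or> ?\<sigma> A \<in> F"
      using that by (auto simp: shift_def split: if_splits)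
    then show ?thesis
      using maximal_intersecting_subset[OF F] \<sigma>_sub \<sigma>(1) by metis
  qed
  have "A \<inter> B \<noteq> {}" if "A \<in> shift m i F" "B \<in> shift m i F" "i \<notin> B" for A B
  proof -
    have "B \<in> F" "?\<sigma> B \<in> F" "A \<in> F \<or> ?\<sigma> A \<in> F"
      using that by (auto simp: shift_def split: if_splits)
    then have "A \<inter> B \<noteq> {} \<or> ?\<sigma> (A \<inter> B) \<noteq> {}"
      using maximal_intersecting_meet[OF F] \<sigma>(4) by metis
    then show ?thesis
      by blast
  qed
  then have "A \<inter> B \<noteq> {}" if "A \<in> shift m i F" "B \<in> shift m i F" for A B
    using that by (metis Int_commute IntI empty_iff)
  moreover have "A \<in> shift m i F \<or> X - A \<in> shift m i F" if A: "A \<subseteq> X" for A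
    using assms(2) maximal_intersecting_Diff_iff[OF F A] maximal_intersecting_Diff_iff[OF F \<sigma>_sub[OF A]]
    by (auto simp: shift_def \<sigma>(3))
  ultimately show ?thesis
    unfolding maximal_intersecting_def using sub by blast
qed

definition irrelevant :: "'a set \<Rightarrow> 'a \<Rightarrow> 'a set set \<Rightarrow> bool" where
  "irrelevant X m F \<longleftrightarrow> (\<forall>A. A \<subseteq> X - {m} \<longrightarrow> (insert m A \<in> F \<longleftrightarrow> A \<in> F))"

lemma maximal_intersecting_remove_irrelevant:
  assumes F: "maximal_intersecting X F" and m: "m \<in> X" "irrelevant X m F"
  shows "maximal_intersecting (X - {m}) (F \<inter> Pow (X - {m}))"
proof -
  have "A \<in> F \<or> X - {m} - A \<in> F" if A: "A \<subseteq> X - {m}" for A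
  proof -
    have "X - A = insert m (X - {m} - A)"
      using A m(1) by auto
    then have "X - A \<in> F \<longleftrightarrow> X - {m} - A \<in> F"
      using m(2) by (auto simp: irrelevant_def)
    then show ?thesis
      using maximal_intersecting_Diff_iff[OF F, of A] A by blast
  qed
  then show ?thesis
    using maximal_intersecting_meet[OF F] unfolding maximal_intersecting_def by blast
qed

lemma minimal_member_if_unshiftable:
  assumes F: "maximal_intersecting X F" and MN: "M \<in> F" "N \<in> F" "M \<inter> N = {m}" "M \<union> N = X"
    and unshiftable: "\<And>i. i \<in> X - N \<Longrightarrow> transpose i m ` N \<in> F"
  shows "minimal_member F M"
proof -
  have "M - {z} \<notin> F" if z: "z \<in> M" for z
  proof (cases "z = m")
    case True
    then have "M - {z} = X - N"
      using MN by blast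
    then show ?thesis
      using maximal_intersecting_Diff_iff[OF F] maximal_intersecting_subset[OF F] MN(2) by metis
  next
    case False
    then have "z \<in> X - N"
      using z MN by blast
    then have "transpose z m ` N \<in> F"
      by (rule unshiftable)
    moreover have "(M - {z}) \<inter> transpose z m ` N = {}"
      using MN(3) \<open>z \<in> X - N\<close> by (auto simp: transpose_def)
    ultimately show ?thesis
      using maximal_intersecting_meet[OF F] by blast
  qed
  then show ?thesis
    using MN(1) by (simp add: minimal_member_def)
qed

text \<open>If \<open>m\<close> were relevant, some \<open>insert m A\<close> and \<open>X - A\<close> would be minimal members meeting
  only in \<open>m\<close>, and one of them contains at least half of \<open>X\<close>.\<close>

lemma irrelevant_if_irreducible:
  assumes X: "m \<in> X" and F: "maximal_intersecting X F"
    and unshiftable: "\<And>i A. i \<in> X \<Longrightarrow> A \<in> F \<Longrightarrow> m \<in> A \<Longrightarrow> i \<notin> A \<Longrightarrow> transpose i m ` A \<in> F"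
    and small: "\<And>M. minimal_member F M \<Longrightarrow> m \<in> M \<Longrightarrow> 2 * card M < card X"
  shows "irrelevant X m F"
proof -
  have "A \<in> F" if A: "A \<subseteq> X - {m}" "insert m A \<in> F" for A
  proof (rule ccontr)
    assume "A \<notin> F"
    define M N where "M = insert m A" and "N = X - A"
    have MN: "M \<in> F" "N \<in> F" "M \<inter> N = {m}" "M \<union> N = X"
      using A X \<open>A \<notin> F\<close> maximal_intersecting_Diff_iff[OF F, of A] by (auto simp: M_def N_def)
    have "minimal_member F M" "minimal_member F N"
      using minimal_member_if_unshiftable[OF F MN] minimal_member_if_unshiftable[OF F MN(2,1)]
        MN unshiftable[of _ M] unshiftable[of _ N] by (auto simp: Int_commute Un_commute)
    then have "2 * card M + 2 * card N < 2 * card X"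
      using small[of M] small[of N] MN(3) by fastforce
    then show False
      using card_Un_le[of M N] MN(4) by simp
  qed
  moreover have "insert m A \<in> F" if "A \<subseteq> X - {m}" "A \<in> F" for A
    using upward_closedD[OF maximal_intersecting_upward_closed[OF F] that(2)] that X by blast
  ultimately show ?thesis
    unfolding irrelevant_def by blast
qed

definition link :: "'a \<Rightarrow> 'a set set \<Rightarrow> 'a set set" where
  "link i F = {A. insert i A \<in> F}"

lemma link_commute: "link i (link m F) = link m (link i F)"
  by (simp add: link_def insert_commute)

lemma upward_closed_link:
  assumes "upward_closed X F" "i \<in> X"
  shows "upward_closed (X - {i}) (link i F)"
  unfolding upward_closed_def
proof (intro allI impI)
  fix A B assume "A \<in> link i F" "A \<subseteq> B" "B \<subseteq> X - {i}"
  then show "B \<in> link i F"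
    using upward_closedD[OF assms(1), of "insert i A" "insert i B"] assms(2) by (auto simp: link_def)
qed

lemma shift_link: "k \<noteq> i \<Longrightarrow> k \<noteq> m \<Longrightarrow> link k (shift m i F) = shift m i (link k F)"
  by (auto simp: shift_def link_def)

lemma shift_restrict:
  assumes "i \<noteq> m" "A \<subseteq> X - {i, m}"
  shows "A \<in> shift m i F \<longleftrightarrow> A \<in> F"
    and "A \<in> link i (shift m i F) \<longleftrightarrow> A \<in> link i F \<union> link m F"
    and "A \<in> link m (shift m i F) \<longleftrightarrow> A \<in> link i F \<inter> link m F"
    and "A \<in> link i (link m (shift m i F)) \<longleftrightarrow> A \<in> link i (link m F)"
proof -
  have "transpose i m ` A = A" "i \<notin> A" "m \<notin> A"
    using assms(2) transpose_image_eq[of i A m] by blast+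
  then show "A \<in> shift m i F \<longleftrightarrow> A \<in> F"
    "A \<in> link i (shift m i F) \<longleftrightarrow> A \<in> link i F \<union> link m F"
    "A \<in> link m (shift m i F) \<longleftrightarrow> A \<in> link i F \<inter> link m F"
    "A \<in> link i (link m (shift m i F)) \<longleftrightarrow> A \<in> link i (link m F)"
    using assms(1) by (auto simp: shift_def link_def insert_commute)
qed

section \<open>Biased measures\<close>

locale bernoulli_weights =
  fixes p q :: real
  assumes p_nonneg: "0 \<le> p" and q_nonneg: "0 \<le> q" and p_plus_q: "p + q = 1"
begin

definition biased_measure :: "'a set \<Rightarrow> 'a set set \<Rightarrow> real" (\<open>\<mu>\<^sub>p\<close>) where
  "\<mu>\<^sub>p X F = (\<Sum>A\<in>Pow X \<inter> F. p ^ card A * q ^ card (X - A))"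

lemma biased_measure_cong: "(\<And>A. A \<subseteq> X \<Longrightarrow> A \<in> F \<longleftrightarrow> A \<in> G) \<Longrightarrow> \<mu>\<^sub>p X F = \<mu>\<^sub>p X G"
  unfolding biased_measure_def by (intro sum.cong) auto

lemma biased_measure_mono:
  "finite X \<Longrightarrow> (\<And>A. A \<subseteq> X \<Longrightarrow> A \<in> F \<Longrightarrow> A \<in> G) \<Longrightarrow> \<mu>\<^sub>p X F \<le> \<mu>\<^sub>p X G"
  unfolding biased_measure_def using p_nonneg q_nonneg by (intro sum_mono2) auto

lemma biased_measure_nonneg: "0 \<le> \<mu>\<^sub>p X F"
  unfolding biased_measure_def using p_nonneg q_nonneg by (intro sum_nonneg) auto

lemma biased_measure_empty: "\<mu>\<^sub>p {} F = of_bool ({} \<in> F)"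
  by (simp add: biased_measure_def)

lemma biased_measure_insert:
  assumes "finite X" "i \<notin> X"
  shows "\<mu>\<^sub>p (insert i X) F = p * \<mu>\<^sub>p X (link i F) + q * \<mu>\<^sub>p X F"
proof -
  let ?w = "\<lambda>X A. p ^ card A * q ^ card (X - A)"
  have split: "Pow (insert i X) \<inter> F = insert i ` (Pow X \<inter> link i F) \<union> (Pow X \<inter> F)"
    by (auto simp: Pow_insert link_def)
  have inj: "inj_on (insert i) (Pow X \<inter> link i F)"
    using assms(2) by (intro inj_onI) (metis Diff_insert_absorb IntD1 PowD subsetD)
  have with_i: "?w (insert i X) (insert i A) = p * ?w X A" if "A \<in> Pow X" for A
  proof -
    have "insert i X - insert i A = X - A" "i \<notin> A" "finite A"
      using that assms by (auto intro: finite_subset)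
    then show ?thesis
      by simp
  qed
  have without_i: "?w (insert i X) A = q * ?w X A" if "A \<in> Pow X" for A
  proof -
    have "insert i X - A = insert i (X - A)" "i \<notin> X - A" "finite (X - A)"
      using that assms by auto
    then show ?thesis
      by simp
  qed
  have "\<mu>\<^sub>p (insert i X) F
      = (\<Sum>A\<in>Pow X \<inter> link i F. ?w (insert i X) (insert i A)) + (\<Sum>A\<in>Pow X \<inter> F. ?w (insert i X) A)"
    unfolding biased_measure_def split using assms inj
    by (subst sum.union_disjoint) (auto simp: sum.reindex)
  also have "\<dots> = p * \<mu>\<^sub>p X (link i F) + q * \<mu>\<^sub>p X F"
    unfolding biased_measure_def sum_distrib_left
    by (intro arg_cong2[where f = "(+)"] sum.cong refl with_i without_i) auto
  finally show ?thesis .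
qed

lemma biased_measure_remove:
  assumes "finite X" "i \<in> X"
  shows "\<mu>\<^sub>p X F = p * \<mu>\<^sub>p (X - {i}) (link i F) + q * \<mu>\<^sub>p (X - {i}) F"
  using biased_measure_insert[of "X - {i}" i F] assms by (simp add: insert_absorb)

lemma biased_measure_UNIV: "finite X \<Longrightarrow> \<mu>\<^sub>p X UNIV = 1"
  by (induction X rule: finite_induct)
    (auto simp: biased_measure_empty biased_measure_insert p_plus_q link_def)

lemma biased_measure_le_1: "finite X \<Longrightarrow> \<mu>\<^sub>p X F \<le> 1"
  using biased_measure_mono[of X F UNIV] by (simp add: biased_measure_UNIV)

lemma biased_measure_Un_Int:
  assumes "finite X"
  shows "\<mu>\<^sub>p X (F \<union> G) + \<mu>\<^sub>p X (F \<inter> G) = \<mu>\<^sub>p X F + \<mu>\<^sub>p X G"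
proof -
  have "Pow X \<inter> (F \<inter> G) = (Pow X \<inter> F) \<inter> (Pow X \<inter> G)"
    by blast
  then show ?thesis
    unfolding biased_measure_def Int_Un_distrib using assms by (simp add: sum.union_inter)
qed

lemma biased_measure_insert_member:
  assumes "finite X" "C \<subseteq> X" "C \<notin> F"
  shows "\<mu>\<^sub>p X (insert C F) = \<mu>\<^sub>p X F + p ^ card C * q ^ card (X - C)"
  using assms by (simp add: biased_measure_def)

lemma biased_measure_nonempty:
  assumes "finite X"
  shows "\<mu>\<^sub>p X (- {{}}) = 1 - q ^ card X"
proof -
  have "insert {} (- {{}}) = (UNIV :: 'a set set)"
    by auto
  then show ?thesis
    using biased_measure_insert_member[OF assms, of "{}" "- {{}}"]
    by (simp add: biased_measure_UNIV[OF assms])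
qed

lemma chebyshev_two_point:
  assumes "b \<le> a" "d \<le> c"
  shows "(p * a + q * b) * (p * c + q * d) \<le> p * (a * c) + q * (b * d)"
proof -
  have q: "q = 1 - p"
    using p_plus_q by simp
  have "0 \<le> p * q * ((a - b) * (c - d))"
    using assms p_nonneg q_nonneg by simp
  also have "\<dots> = p * (a * c) + q * (b * d) - (p * a + q * b) * (p * c + q * d)"
    unfolding q by (simp add: algebra_simps)
  finally show ?thesis
    by simp
qed

lemma harris_inequality:
  assumes "finite X" "upward_closed X F" "upward_closed X G"
  shows "\<mu>\<^sub>p X F * \<mu>\<^sub>p X G \<le> \<mu>\<^sub>p X (F \<inter> G)"
  using assms
proof (induction X arbitrary: F G rule: finite_induct)
  case empty
  then show ?case
    by (simp add: biased_measure_empty)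
next
  case (insert i X)
  have closed: "upward_closed X H" "upward_closed X (link i H)" "\<mu>\<^sub>p X H \<le> \<mu>\<^sub>p X (link i H)"
    if H: "upward_closed (insert i X) H" for H
  proof -
    show "upward_closed X H"
      using H unfolding upward_closed_def by blast
    show "upward_closed X (link i H)"
      using upward_closed_link[OF H, of i] insert.hyps(2) by simp
    show "\<mu>\<^sub>p X H \<le> \<mu>\<^sub>p X (link i H)"
      using insert.hyps by (intro biased_measure_mono) (auto simp: link_def intro: upward_closedD[OF H])
  qed
  note F = closed[OF insert.prems(1)] and G = closed[OF insert.prems(2)]
  have "\<mu>\<^sub>p (insert i X) F * \<mu>\<^sub>p (insert i X) G
      \<le> p * (\<mu>\<^sub>p X (link i F) * \<mu>\<^sub>p X (link i G)) + q * (\<mu>\<^sub>p X F * \<mu>\<^sub>p X G)"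
    using insert.hyps chebyshev_two_point[OF F(3) G(3)] by (simp add: biased_measure_insert)
  also have "\<dots> \<le> p * \<mu>\<^sub>p X (link i F \<inter> link i G) + q * \<mu>\<^sub>p X (F \<inter> G)"
    using p_nonneg q_nonneg by (intro add_mono mult_left_mono insert.IH F G)
  also have "link i F \<inter> link i G = link i (F \<inter> G)"
    by (auto simp: link_def)
  finally show ?case
    using insert.hyps by (simp add: biased_measure_insert)
qed

lemma biased_measure_Un_upward_closed_le:
  assumes "finite X" "upward_closed X F" "upward_closed X G"
  shows "\<mu>\<^sub>p X (F \<union> G) \<le> \<mu>\<^sub>p X F + \<mu>\<^sub>p X G - \<mu>\<^sub>p X F * \<mu>\<^sub>p X G"
  using harris_inequality[OF assms] biased_measure_Un_Int[OF assms(1), of F G] by simp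

lemma biased_measure_shift:
  assumes X: "finite X" and im: "i \<in> X" "m \<in> X" "i \<noteq> m"
  shows "\<mu>\<^sub>p X (shift m i F) = \<mu>\<^sub>p X F"
proof -
  define Y where "Y = X - {i, m}"
  have two_points: "\<mu>\<^sub>p X G = p * p * \<mu>\<^sub>p Y (link i (link m G))
      + p * q * (\<mu>\<^sub>p Y (link i G) + \<mu>\<^sub>p Y (link m G)) + q * q * \<mu>\<^sub>p Y G" for G
  proof -
    have "X - {m} - {i} = Y"
      by (auto simp: Y_def)
    then show ?thesis
      using biased_measure_remove[OF X im(2), of G] biased_measure_remove[of "X - {m}" i] X im
      by (simp add: algebra_simps)
  qed
  have "\<mu>\<^sub>p Y (shift m i F) = \<mu>\<^sub>p Y F"
    "\<mu>\<^sub>p Y (link i (shift m i F)) = \<mu>\<^sub>p Y (link i F \<union> link m F)"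
    "\<mu>\<^sub>p Y (link m (shift m i F)) = \<mu>\<^sub>p Y (link i F \<inter> link m F)"
    "\<mu>\<^sub>p Y (link i (link m (shift m i F))) = \<mu>\<^sub>p Y (link i (link m F))"
    unfolding Y_def by (rule biased_measure_cong, simp add: shift_restrict[OF im(3)])+
  then show ?thesis
    unfolding two_points using biased_measure_Un_Int[of Y "link i F" "link m F"] X by (simp add: Y_def)
qed

lemma biased_measure_irrelevant:
  assumes "finite X" "m \<in> X" "irrelevant X m F"
  shows "\<mu>\<^sub>p X F = \<mu>\<^sub>p (X - {m}) F"
proof -
  have "\<mu>\<^sub>p (X - {m}) (link m F) = \<mu>\<^sub>p (X - {m}) F"
    using assms(3) by (intro biased_measure_cong) (auto simp: irrelevant_def link_def)
  then have "\<mu>\<^sub>p X F = (p + q) * \<mu>\<^sub>p (X - {m}) F"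
    using biased_measure_remove[OF assms(1,2), of F] by (simp add: distrib_right)
  then show ?thesis
    by (simp add: p_plus_q)
qed

definition link_measure :: "'a set \<Rightarrow> 'a \<Rightarrow> 'a set set \<Rightarrow> real" where
  "link_measure X i F = \<mu>\<^sub>p (X - {i}) (link i F)"

lemma link_measure_remove:
  assumes "finite X" "m \<in> X" "i \<noteq> m"
  shows "link_measure X i F = p * \<mu>\<^sub>p (X - {i, m}) (link i (link m F)) + q * \<mu>\<^sub>p (X - {i, m}) (link i F)"
proof -
  have "X - {i} - {m} = X - {i, m}"
    by auto
  then show ?thesis
    using biased_measure_remove[of "X - {i}" m "link i F"] assms
    by (simp add: link_measure_def link_commute[of i m])
qed

lemma link_measure_irrelevant:
  assumes "finite X" "m \<in> X" "i \<in> X" "i \<noteq> m" "irrelevant X m F"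
  shows "link_measure X i F = link_measure (X - {m}) i F"
proof -
  have "irrelevant (X - {i}) m (link i F)"
    unfolding irrelevant_def
  proof (intro allI impI)
    fix A assume "A \<subseteq> X - {i} - {m}"
    then have "insert i A \<subseteq> X - {m}"
      using assms(3,4) by blast
    then show "insert m A \<in> link i F \<longleftrightarrow> A \<in> link i F"
      using assms(5) by (simp add: irrelevant_def link_def insert_commute[of i m])
  qed
  then show ?thesis
    unfolding link_measure_def using biased_measure_irrelevant[of "X - {i}" m "link i F"] assms
    by (simp add: Diff_insert2[symmetric] insert_commute)
qed

lemma link_measure_shift_other:
  assumes "finite X" "i \<in> X" "m \<in> X" "i \<noteq> m" "k \<noteq> i" "k \<noteq> m"
  shows "link_measure X k (shift m i F) = link_measure X k F"
  unfolding link_measure_def using assms by (simp add: shift_link biased_measure_shift)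

lemma link_measure_shift_source_le:
  assumes "finite X"
  shows "link_measure X m (shift m i F) \<le> link_measure X m F"
  unfolding link_measure_def using assms
  by (intro biased_measure_mono) (auto simp: link_def shift_def simp del: image_insert split: if_splits)

lemma link_measure_shift_target:
  assumes "finite X" "m \<in> X" "i \<noteq> m"
  shows "link_measure X i (shift m i F)
    = p * \<mu>\<^sub>p (X - {i, m}) (link i (link m F)) + q * \<mu>\<^sub>p (X - {i, m}) (link i F \<union> link m F)"
proof -
  have "\<mu>\<^sub>p (X - {i, m}) (link i (shift m i F)) = \<mu>\<^sub>p (X - {i, m}) (link i F \<union> link m F)"
    "\<mu>\<^sub>p (X - {i, m}) (link i (link m (shift m i F))) = \<mu>\<^sub>p (X - {i, m}) (link i (link m F))"
    by (rule biased_measure_cong, simp add: shift_restrict[OF assms(3)])+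
  then show ?thesis
    using link_measure_remove[OF assms] by simp
qed

lemma link_measure_insert_member_le:
  assumes X: "finite X" "i \<in> X" and C: "C \<subseteq> X" "C \<notin> F"
  shows "link_measure X i (insert C F) \<le> link_measure X i F + p ^ (card C - 1) * q ^ card (X - C)"
proof (cases "i \<in> C")
  case True
  have "link_measure X i (insert C F) = \<mu>\<^sub>p (X - {i}) (insert (C - {i}) (link i F))"
    unfolding link_measure_def using True by (intro biased_measure_cong) (auto simp: link_def)
  also have "\<dots> = link_measure X i F + p ^ card (C - {i}) * q ^ card (X - {i} - (C - {i}))"
    unfolding link_measure_def using X C True
    by (intro biased_measure_insert_member) (auto simp: link_def insert_absorb)
  also have "X - {i} - (C - {i}) = X - C"
    using True by auto
  finally show ?thesis
    using True finite_subset[OF C(1) X(1)] by simp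
next
  case False
  then have "link i (insert C F) = link i F"
    by (auto simp: link_def)
  then show ?thesis
    using p_nonneg q_nonneg by (simp add: link_measure_def)
qed

end

section \<open>Inequalities for the exponent\<close>

lemma ln_le_mult_ln_4:
  fixes x :: real
  assumes "3 \<le> x"
  shows "ln x \<le> (x - 2) * ln 4"
proof -
  have "1 \<le> ln (4 :: real)"
    using ln_ge_iff[of 4 1] exp_le by simp
  then have "x / 3 - 1 \<le> (x - 3) * ln 4"
    using assms mult_left_mono[of 1 "ln 4" "x - 3"] by simp
  moreover have "ln x = ln 3 + ln (x / 3)"
    using assms by (simp add: ln_div)
  moreover have "ln (x / 3) \<le> x / 3 - 1"
    using assms by (intro ln_le_minus_one) simp
  moreover have "ln 3 \<le> ln (4 :: real)"
    by simp
  ultimately have "ln x \<le> ln 4 + (x - 3) * ln 4"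
    by linarith
  then show ?thesis
    by (simp add: algebra_simps)
qed

locale skewed_weights = bernoulli_weights p q for p q +
  fixes \<eta> :: real
  assumes p_pos: "0 < p" and p_le_q: "p \<le> q" and q_powr_eta: "q powr \<eta> = p"
begin

lemma q_eq: "q = 1 - p" and q_pos: "0 < q" and q_less_1: "q < 1"
  using p_pos p_le_q p_plus_q by auto

lemma eta_ge_1: "1 \<le> \<eta>"
proof (rule ccontr)
  assume "\<not> 1 \<le> \<eta>"
  then have "q powr 1 < q powr \<eta>"
    using q_pos q_less_1 by (intro powr_less_mono') auto
  then show False
    using p_le_q q_pos by (simp add: q_powr_eta)
qed

lemma q_power_powr_eta: "(q ^ k) powr \<eta> = p ^ k"
  using q_pos by (induction k) (auto simp: powr_mult q_powr_eta)

lemma q_powr_eta_minus_1: "q * q powr (\<eta> - 1) = p"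
  using q_pos q_powr_eta by (simp add: powr_mult_base)

lemma two_point_inequality:
  assumes "0 \<le> y" "y \<le> z"
  shows "p * z powr \<eta> + q * y powr \<eta> \<le> (q * z + p * y) powr \<eta>"
proof (cases "y = 0")
  case True
  then show ?thesis
    using assms q_pos by (simp add: powr_mult q_powr_eta)
next
  case False
  define g where "g = (\<lambda>z. (q * z + p * y) powr \<eta> - p * z powr \<eta> - q * y powr \<eta>)"
  have "g y \<le> g z"
  proof (rule DERIV_nonneg_imp_nondecreasing[OF assms(2)])
    fix x assume x: "y \<le> x" "x \<le> z"
    define g' where "g' = \<eta> * (q * (q * x + p * y) powr (\<eta> - 1) - p * x powr (\<eta> - 1))"
    have pos: "0 < x" "0 < q * x + p * y"
      using x False assms p_pos q_pos by (auto intro!: add_pos_pos)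
    have "p * x powr (\<eta> - 1) = q * (q * x) powr (\<eta> - 1)"
      using pos q_pos q_powr_eta_minus_1 by (simp add: powr_mult flip: mult.assoc)
    also have "\<dots> \<le> q * (q * x + p * y) powr (\<eta> - 1)"
      using pos q_pos p_pos assms eta_ge_1 by (intro mult_left_mono powr_mono2) auto
    finally have "0 \<le> g'"
      using eta_ge_1 by (simp add: g'_def)
    moreover have "(g has_real_derivative g') (at x)"
      unfolding g_def g'_def using pos by (auto intro!: derivative_eq_intros simp: algebra_simps)
    ultimately show "\<exists>d. (g has_real_derivative d) (at x) \<and> 0 \<le> d"
      by blast
  qed
  moreover have "q * y + p * y = y" "y powr \<eta> = p * y powr \<eta> + q * y powr \<eta>"
    by (simp_all add: q_eq algebra_simps)
  ultimately show ?thesis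
    by (simp add: g_def)
qed

lemma isoperimetric_step:
  assumes "v \<le> u" "u \<le> 1" "d \<le> p * u + q * v" "b \<le> p * (1 - v) powr \<eta> + q * (1 - u) powr \<eta>"
  shows "b \<le> (1 - d) powr \<eta>"
proof -
  have "b \<le> (q * (1 - v) + p * (1 - u)) powr \<eta>"
    using assms two_point_inequality[of "1 - u" "1 - v"] by simp
  also have "\<dots> \<le> (1 - d) powr \<eta>"
  proof (rule powr_mono2)
    show "q * (1 - v) + p * (1 - u) \<le> 1 - d"
      using assms(3) p_plus_q by (simp add: algebra_simps)
  qed (use assms(1,2) eta_ge_1 p_pos q_pos in auto)
  finally show ?thesis .
qed

lemma affine_plus_powr_le_endpoints:
  assumes "0 < x" "x \<le> v" "v \<le> y" "0 \<le> c"
    and "a + b * x + c * x powr \<eta> \<le> M" "a + b * y + c * y powr \<eta> \<le> M"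
  shows "a + b * v + c * v powr \<eta> \<le> M"
proof -
  have "convex_on {x..y} (\<lambda>v. v powr \<eta>)"
    using assms(1) by (intro convex_on_subset[OF powr_convex[OF eta_ge_1]]) auto
  moreover have "a + b * (u * r + w * s) = u * (a + b * r) + w * (a + b * s)" if "u + w = 1" for u w r s
    using that by algebra
  then have "convex_on {x..y} (\<lambda>v. a + b * v)"
    by (auto simp: convex_on_def)
  ultimately have "convex_on {x..y} (\<lambda>v. a + b * v + c * v powr \<eta>)"
    using convex_on_add[OF _ convex_on_cmul] assms(4) by blast
  then show ?thesis
    using convex_on_le_max[of x y "\<lambda>v. a + b * v + c * v powr \<eta>" v] assms by fastforce
qed

text \<open>The probability that at least two of three independent events of probability \<open>p\<close> occur.\<close>

definition threshold :: real where "threshold = 3 * p\<^sup>2 - 2 * p ^ 3"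

lemma threshold_eq: "threshold = p * (1 - q * (q - p))"
  by (simp add: threshold_def q_eq algebra_simps power2_eq_square power3_eq_cube)

lemma below_or_above_gap:
  assumes "threshold < p * a + q * (1 - a) powr \<eta>"
  shows "a < 1 - q\<^sup>2 \<or> 1 - q ^ 3 < a"
proof (rule ccontr)
  assume "\<not> ?thesis"
  then have "q ^ 3 \<le> 1 - a" "1 - a \<le> q\<^sup>2"
    by auto
  moreover have "p + - p * q ^ 3 + q * p ^ 3 = threshold" "p + - p * q\<^sup>2 + q * p\<^sup>2 = threshold"
    by (simp_all add: threshold_def q_eq algebra_simps power2_eq_square power3_eq_cube)
  ultimately have "p + - p * (1 - a) + q * (1 - a) powr \<eta> \<le> threshold"
    using affine_plus_powr_le_endpoints[of "q ^ 3" "1 - a" "q\<^sup>2" q p "- p" threshold] q_pos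
    by (simp add: q_power_powr_eta)
  then show False
    using assms by (simp add: algebra_simps)
qed

lemma gap_width: "1 - q ^ 3 = (1 - q\<^sup>2) + p * q\<^sup>2"
  by (simp add: q_eq algebra_simps power2_eq_square power3_eq_cube)

lemma gap_endpoints_le: "1 - q\<^sup>2 \<le> 1 - q ^ 3"
  using p_pos by (simp add: gap_width)

lemma sum_of_two_densities_below_gap:
  assumes "p \<le> q\<^sup>2" and b: "c \<le> b" "b \<le> 1 - q\<^sup>2" "c \<le> (1 - b) powr \<eta>"
  shows "b + c \<le> 1 - q ^ 3"
proof -
  have "b + c \<le> 2 * p"
  proof (cases "b \<le> p")
    case False
    have "1 + - 1 * q\<^sup>2 + 1 * p\<^sup>2 = 2 * p" "1 + - 1 * q + 1 * p = 2 * p"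
      by (simp_all add: q_eq algebra_simps power2_eq_square)
    moreover have "1 - b \<le> q"
      using False by (simp add: q_eq)
    ultimately have "1 + - 1 * (1 - b) + 1 * (1 - b) powr \<eta> \<le> 2 * p"
      using affine_plus_powr_le_endpoints[of "q\<^sup>2" "1 - b" q 1 1 "- 1" "2 * p"] b q_pos
      by (simp add: q_power_powr_eta q_powr_eta)
    then show ?thesis
      using b by simp
  qed (use b in auto)
  also have "\<dots> \<le> 2 * p + p * (q\<^sup>2 - p)"
    using assms(1) p_pos by simp
  also have "\<dots> = 1 - q ^ 3"
    by (simp add: q_eq algebra_simps power2_eq_square power3_eq_cube)
  finally show ?thesis .
qed

lemma union_below_gap:
  assumes "u \<le> 1" "y \<le> x" "0 \<le> y" "x \<le> 1" "y \<le> (1 - x) powr \<eta>" "p * u + q * x < 1 - q\<^sup>2"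
  shows "p * u + q * (x + y - x * y) \<le> 1 - q ^ 3"
proof (cases "x \<le> p")
  case True
  have "q * q \<le> (1 - x) * (1 - y)"
    using True assms q_pos by (intro mult_mono) (auto simp: q_eq)
  then have "q * (x + y - x * y) \<le> q * (1 - q\<^sup>2)"
    using q_pos by (intro mult_left_mono) (auto simp: algebra_simps power2_eq_square)
  moreover have "p * u \<le> p"
    using assms(1) p_pos by simp
  ultimately have "p * u + q * (x + y - x * y) \<le> p + q * (1 - q\<^sup>2)"
    by simp
  also have "\<dots> = 1 - q ^ 3"
    by (simp add: q_eq algebra_simps power2_eq_square power3_eq_cube)
  finally show ?thesis .
next
  case False
  then have "1 - x \<le> q"
    by (simp add: q_eq)
  then have "(1 - x) powr \<eta> \<le> p"
    using assms(4) eta_ge_1 powr_mono2[of \<eta> "1 - x" q] by (simp add: q_powr_eta)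
  then have "y * (1 - x) \<le> p * q"
    using \<open>1 - x \<le> q\<close> assms p_pos by (intro mult_mono) auto
  then have "q * (y * (1 - x)) \<le> q * (p * q)"
    using q_pos by simp
  then have "p * u + q * (x + y - x * y) \<le> (1 - q\<^sup>2) + q * (p * q)"
    using assms(6) by (simp add: algebra_simps)
  also have "\<dots> = 1 - q ^ 3"
    by (simp add: gap_width power2_eq_square)
  finally show ?thesis .
qed

lemma eta_le: "\<eta> \<le> ln (1 / p) / p"
proof -
  have "ln q \<le> - p"
    using ln_add_one_self_le_self2[of "- p"] p_pos q_pos by (simp add: q_eq)
  then have "\<eta> * p \<le> \<eta> * - ln q"
    using eta_ge_1 by (intro mult_left_mono) auto
  also have "\<eta> * - ln q = ln (1 / p)"
    using q_pos p_pos ln_powr[of q \<eta>] by (simp add: q_powr_eta ln_div)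
  finally show ?thesis
    using p_pos by (simp add: pos_le_divide_eq)
qed

lemma one_minus_square_odds_powr_eta_ge:
  assumes "p \<le> 1 / 3"
  shows "1 / 4 \<le> (1 - p\<^sup>2 / q\<^sup>2) powr \<eta>"
proof -
  define w where "w = p\<^sup>2 / (q - p)"
  have gap_pos: "0 < q - p"
    using assms by (simp add: q_eq)
  have "q\<^sup>2 - p\<^sup>2 = q - p"
    using p_plus_q by algebra
  then have "1 - p\<^sup>2 / q\<^sup>2 = (q - p) / q\<^sup>2" "1 + w = q\<^sup>2 / (q - p)"
    using gap_pos q_pos by (auto simp: w_def field_simps)
  then have base: "1 - p\<^sup>2 / q\<^sup>2 = 1 / (1 + w)" and w: "0 \<le> w"
    using gap_pos by (auto simp: w_def)
  have "p * ln (1 / p) \<le> p * ((1 / p - 2) * ln 4)"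
    using ln_le_mult_ln_4[of "1 / p"] assms p_pos by (intro mult_left_mono) (auto simp: field_simps)
  also have "\<dots> = (q - p) * ln 4"
    using p_pos by (simp add: q_eq field_simps)
  finally have ln_p: "p * ln (1 / p) \<le> (q - p) * ln 4" .
  have "\<eta> * ln (1 + w) \<le> ln (1 / p) / p * w"
    using eta_le eta_ge_1 w ln_add_one_self_le_self[OF w] by (intro mult_mono) auto
  also have "\<dots> = p * ln (1 / p) / (q - p)"
    using p_pos by (simp add: w_def power2_eq_square)
  also have "\<dots> \<le> ln 4"
    using ln_p gap_pos by (simp add: pos_divide_le_eq mult.commute)
  finally have "(1 + w) powr \<eta> \<le> 4"
    using w by (simp add: powr_def ln_ge_iff[symmetric])
  then show ?thesis
    using w by (simp add: base powr_divide field_simps)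
qed

lemma powr_eta_le_deficit_powr_eta:
  assumes "p \<le> 1 / 3" and v: "0 \<le> v" "v \<le> q ^ 3" and d: "d \<le> p * (1 - v) + q * v powr \<eta>"
  shows "v powr \<eta> \<le> 4 * (1 - d / p) powr \<eta>"
proof -
  have "v powr \<eta> = v * v powr (\<eta> - 1)"
    using v by (simp add: powr_mult_base)
  also have "\<dots> \<le> v * (q ^ 3) powr (\<eta> - 1)"
    using v eta_ge_1 by (intro mult_left_mono powr_mono2) auto
  also have "(q ^ 3) powr (\<eta> - 1) = p ^ 3 / q ^ 3"
    using q_pos by (simp add: powr_diff q_power_powr_eta)
  finally have "q / p * v powr \<eta> \<le> q / p * (v * (p ^ 3 / q ^ 3))"
    using p_pos q_pos by (intro mult_left_mono) auto
  also have "\<dots> = v * (p\<^sup>2 / q\<^sup>2)"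
    using p_pos q_pos by (simp add: field_simps power2_eq_square power3_eq_cube)
  finally have "v * (1 - p\<^sup>2 / q\<^sup>2) \<le> v - q / p * v powr \<eta>"
    by (simp add: algebra_simps)
  also have "\<dots> \<le> 1 - d / p"
    using divide_right_mono[OF d, of p] p_pos by (simp add: add_divide_distrib)
  finally have deficit: "v * (1 - p\<^sup>2 / q\<^sup>2) \<le> 1 - d / p" .
  have "p\<^sup>2 \<le> q\<^sup>2"
    using p_pos p_le_q by (intro power_mono) auto
  then have "0 \<le> 1 - p\<^sup>2 / q\<^sup>2"
    using q_pos by simp
  have "1 * v powr \<eta> \<le> (4 * (1 - p\<^sup>2 / q\<^sup>2) powr \<eta>) * v powr \<eta>"
    using one_minus_square_odds_powr_eta_ge[OF assms(1)] by (intro mult_right_mono) auto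
  also have "\<dots> = 4 * (v * (1 - p\<^sup>2 / q\<^sup>2)) powr \<eta>"
    by (simp add: powr_mult)
  also have "\<dots> \<le> 4 * (1 - d / p) powr \<eta>"
    using deficit v \<open>0 \<le> 1 - p\<^sup>2 / q\<^sup>2\<close> eta_ge_1 by (intro mult_left_mono powr_mono2) auto
  finally show ?thesis
    by simp
qed

section \<open>Intersecting families of large biased measure\<close>

lemma cross_intersecting_bound:
  assumes "finite X" "\<And>A B. A \<subseteq> X \<Longrightarrow> B \<subseteq> X \<Longrightarrow> A \<in> F \<Longrightarrow> B \<in> G \<Longrightarrow> A \<inter> B \<noteq> {}"
  shows "\<mu>\<^sub>p X G \<le> (1 - \<mu>\<^sub>p X F) powr \<eta>"
  using assms
proof (induction X arbitrary: F G rule: finite_induct)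
  case empty
  then have "{} \<notin> F \<or> {} \<notin> G"
    by blast
  then show ?case
    by (auto simp: biased_measure_empty)
next
  case (insert i X)
  note cross = insert.prems
  define f1 f0 where "f1 = \<mu>\<^sub>p X (link i F)" and "f0 = \<mu>\<^sub>p X F"
  have "\<mu>\<^sub>p X (link i G) \<le> (1 - f0) powr \<eta>"
    unfolding f0_def
  proof (rule insert.IH)
    fix A B assume "A \<subseteq> X" "B \<subseteq> X" "A \<in> F" "B \<in> link i G"
    then show "A \<inter> B \<noteq> {}"
      using cross[of A "insert i B"] insert.hyps(2) by (auto simp: link_def)
  qed
  moreover have "\<mu>\<^sub>p X G \<le> (1 - f1) powr \<eta>"
    unfolding f1_def
  proof (rule insert.IH)
    fix A B assume "A \<subseteq> X" "B \<subseteq> X" "A \<in> link i F" "B \<in> G"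
    then show "A \<inter> B \<noteq> {}"
      using cross[of "insert i A" B] insert.hyps(2) by (auto simp: link_def)
  qed
  moreover have "\<mu>\<^sub>p X G \<le> (1 - f0) powr \<eta>"
    unfolding f0_def using cross by (intro insert.IH) auto
  ultimately have "\<mu>\<^sub>p (insert i X) G \<le> p * (1 - f0) powr \<eta> + q * (1 - max f1 f0) powr \<eta>"
    using insert.hyps p_pos q_pos by (auto simp: biased_measure_insert max_def intro!: add_mono)
  moreover have "max f1 f0 \<le> 1"
    using biased_measure_le_1[OF insert.hyps(1)] by (simp add: f1_def f0_def)
  moreover have "\<mu>\<^sub>p (insert i X) F \<le> p * max f1 f0 + q * f0"
    using insert.hyps p_pos by (simp add: biased_measure_insert flip: f1_def f0_def)
  ultimately show ?case
    using isoperimetric_step[of f0 "max f1 f0"] by simp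
qed

lemma link_measure_gap:
  assumes X: "finite X" "i \<in> X" and F: "maximal_intersecting X F" "threshold < \<mu>\<^sub>p X F"
  shows "link_measure X i F < 1 - q\<^sup>2 \<or> 1 - q ^ 3 < link_measure X i F"
proof (rule below_or_above_gap)
  have "\<mu>\<^sub>p (X - {i}) F \<le> (1 - link_measure X i F) powr \<eta>"
    unfolding link_measure_def
  proof (rule cross_intersecting_bound)
    fix A B assume AB: "A \<subseteq> X - {i}" "B \<subseteq> X - {i}" "A \<in> link i F" "B \<in> F"
    then have "insert i A \<inter> B \<noteq> {}"
      using maximal_intersecting_meet[OF F(1), of "insert i A" B] by (simp add: link_def)
    then show "A \<inter> B \<noteq> {}"
      using AB by auto
  qed (use X in auto)
  then have "p * link_measure X i F + q * \<mu>\<^sub>p (X - {i}) F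
      \<le> p * link_measure X i F + q * (1 - link_measure X i F) powr \<eta>"
    using q_pos by simp
  then show "threshold < p * link_measure X i F + q * (1 - link_measure X i F) powr \<eta>"
    using F(2) unfolding biased_measure_remove[OF X, of F] link_measure_def by linarith
qed

definition has_dominant_link :: "'a set \<Rightarrow> 'a set set \<Rightarrow> bool" where
  "has_dominant_link X F \<longleftrightarrow> (\<exists>i\<in>X. 1 - q ^ 3 < link_measure X i F)"

lemma has_dominant_linkI:
  assumes "finite X" "i \<in> X" "maximal_intersecting X F" "threshold < \<mu>\<^sub>p X F"
    and "1 - q\<^sup>2 \<le> link_measure X i F"
  shows "has_dominant_link X F"
  using link_measure_gap[OF assms(1-4)] assms(2,5) by (force simp: has_dominant_link_def)

lemma has_dominant_link_if_singleton:
  assumes X: "finite X" "i \<in> X" and F: "maximal_intersecting X F" and "{i} \<in> F"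
  shows "has_dominant_link X F"
proof -
  have "\<mu>\<^sub>p (X - {i}) (link i F) = \<mu>\<^sub>p (X - {i}) UNIV"
    using X upward_closedD[OF maximal_intersecting_upward_closed[OF F] assms(4)]
    by (intro biased_measure_cong) (auto simp: link_def)
  then have "link_measure X i F = 1"
    using X(1) by (simp add: link_measure_def biased_measure_UNIV)
  then show ?thesis
    using X(2) q_pos unfolding has_dominant_link_def by (intro bexI[of _ i]) auto
qed

lemma biased_measure_two_le_threshold:
  assumes "finite X" "card X \<le> 3"
  shows "\<mu>\<^sub>p X {A. 2 \<le> card A} \<le> threshold"
proof -
  have "threshold = p * p + 2 * (p * p * q)"
    by (simp add: threshold_def q_eq algebra_simps power2_eq_square power3_eq_cube)
  moreover have "0 \<le> p * p" "0 \<le> p * p * q"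
    using q_pos by auto
  ultimately have small: "0 \<le> threshold" "p * p \<le> threshold" "p * (p + q * p) + q * (p * p) \<le> threshold"
    by (auto simp: algebra_simps)
  note expand = biased_measure_insert biased_measure_empty link_def
  consider "card X = 0" | "card X = 1" | "card X = 2" | "card X = 3"
    using assms(2) by linarith
  then show ?thesis
  proof cases
    case 1
    then have "X = {}"
      using assms(1) by simp
    then show ?thesis
      using small by (simp add: expand)
  next
    case 2
    then obtain a where "X = {a}"
      using card_1_singletonE by blast
    then show ?thesis
      using small by (simp add: expand)
  next
    case 3
    then obtain a b where "X = {a, b}" "a \<noteq> b"
      by (auto simp: card_2_iff)
    then show ?thesis
      using small by (simp add: expand)
  next
    case 4
    then obtain a b c where "X = {a, b, c}" "a \<noteq> b" "b \<noteq> c" "a \<noteq> c"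
      by (auto simp: card_3_iff)
    then show ?thesis
      using small by (simp add: expand p_plus_q)
  qed
qed

lemma singleton_member_if_small:
  assumes X: "finite X" "card X \<le> 3" and F: "maximal_intersecting X F" "threshold < \<mu>\<^sub>p X F"
  obtains i where "i \<in> X" "{i} \<in> F"
proof -
  have "\<exists>i\<in>X. {i} \<in> F"
  proof (rule ccontr)
    assume no: "\<not> ?thesis"
    have "\<mu>\<^sub>p X F \<le> \<mu>\<^sub>p X {A. 2 \<le> card A}"
    proof (rule biased_measure_mono[OF X(1)])
      fix A assume A: "A \<subseteq> X" "A \<in> F"
      then have "finite A" "A \<noteq> {}"
        using maximal_intersecting_meet[OF F(1), of A A] X(1) finite_subset by auto
      moreover have "card A \<noteq> 1"
        using no A card_1_singletonE by (metis insert_subset)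
      ultimately have "card A \<noteq> 0" "card A \<noteq> 1"
        by auto
      then show "A \<in> {A. 2 \<le> card A}"
        by simp
    qed
    then show False
      using biased_measure_two_le_threshold[OF X] F(2) by simp
  qed
  then show ?thesis
    using that by blast
qed

lemma weight_le_swapped_weight:
  assumes "c \<le> m"
  shows "p ^ m * q ^ c \<le> p ^ c * q ^ m"
proof -
  have "p ^ m * q ^ c = (p * q) ^ c * p ^ (m - c)"
    using assms by (simp add: power_mult_distrib flip: power_add)
  also have "\<dots> \<le> (p * q) ^ c * q ^ (m - c)"
    using p_pos q_pos p_le_q by (intro mult_left_mono power_mono) auto
  also have "\<dots> = p ^ c * q ^ m"
    using assms by (simp add: power_mult_distrib flip: power_add)
  finally show ?thesis .
qed

lemma biased_measure_exchange_ge: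
  assumes X: "finite X" and F: "maximal_intersecting X F" and M: "M \<in> F" "card X \<le> 2 * card M"
  shows "\<mu>\<^sub>p X F \<le> \<mu>\<^sub>p X (exchange X M F)"
proof -
  have MX: "M \<subseteq> X" "X - M \<notin> F - {M}"
    using M maximal_intersecting_subset[OF F] maximal_intersecting_Diff_iff[OF F, of M] by auto
  have "card (X - M) \<le> card M"
    using M(2) MX(1) X by (simp add: card_Diff_subset finite_subset)
  then have "p ^ card M * q ^ card (X - M) \<le> p ^ card (X - M) * q ^ card (X - (X - M))"
    using weight_le_swapped_weight[of "card (X - M)" "card M"] MX(1) by (simp add: double_diff)
  moreover have "\<mu>\<^sub>p X F = \<mu>\<^sub>p X (F - {M}) + p ^ card M * q ^ card (X - M)"
    using biased_measure_insert_member[OF X MX(1), of "F - {M}"] M(1) by (simp add: insert_absorb)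
  moreover have "\<mu>\<^sub>p X (exchange X M F)
      = \<mu>\<^sub>p X (F - {M}) + p ^ card (X - M) * q ^ card (X - (X - M))"
    unfolding exchange_def using MX(2) by (intro biased_measure_insert_member[OF X]) auto
  ultimately show ?thesis
    by simp
qed

lemma link_measure_above_minimal_coatom:
  assumes X: "finite X" "i \<in> X" and F: "maximal_intersecting X F" and M: "minimal_member F (X - {i})"
  shows "1 - q ^ (card X - 1) \<le> link_measure X i F"
proof -
  have "\<mu>\<^sub>p (X - {i}) (- {{}}) \<le> link_measure X i F"
    unfolding link_measure_def
  proof (rule biased_measure_mono)
    fix A assume A: "A \<subseteq> X - {i}" "A \<in> - {{}}"
    then have "X - insert i A \<notin> F"
      using X(2) by (intro not_member_below_minimal[OF F M]) auto
    then show "A \<in> link i F"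
      using maximal_intersecting_Diff_iff[OF F, of "insert i A"] A X(2) by (auto simp: link_def)
  qed (use X in simp)
  then show ?thesis
    using X by (simp add: biased_measure_nonempty)
qed

lemma link_measure_exchange_le:
  assumes X: "finite X" "i \<in> X" and F: "maximal_intersecting X F"
    and M: "M \<in> F" "2 \<le> card M" "2 \<le> card (X - M)"
  shows "link_measure X i (exchange X M F) \<le> link_measure X i F + p * q\<^sup>2"
proof -
  have MX: "M \<subseteq> X" "X - M \<notin> F"
    using M(1) maximal_intersecting_subset[OF F] maximal_intersecting_Diff_iff[OF F, of M] by auto
  have "link_measure X i (exchange X M F) \<le> link_measure X i (insert (X - M) F)"
    unfolding link_measure_def exchange_def using X(1)
    by (intro biased_measure_mono) (auto simp: link_def)
  also have "\<dots> \<le> link_measure X i F + p ^ (card (X - M) - 1) * q ^ card M"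
    using link_measure_insert_member_le[OF X _ MX(2)] MX(1) by (simp add: double_diff)
  also have "p ^ (card (X - M) - 1) * q ^ card M \<le> p ^ 1 * q\<^sup>2"
    using M(2,3) p_pos q_pos q_less_1 p_plus_q by (intro mult_mono power_decreasing) auto
  finally show ?thesis
    by simp
qed

lemma has_dominant_link_exchangeD:
  assumes X: "finite X" "4 \<le> card X" and F: "maximal_intersecting X F" "threshold < \<mu>\<^sub>p X F"
    and M: "minimal_member F M" "card X \<le> 2 * card M"
    and dominant: "has_dominant_link X (exchange X M F)"
  shows "has_dominant_link X F"
proof -
  have MF: "M \<in> F" "M \<subseteq> X" "M \<noteq> X"
    using M maximal_intersecting_subset[OF F(1)] minimal_member_neq_ground[OF F(1) M(1)] X(2)
    by (auto simp: minimal_member_def)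
  then have "card (X - M) \<noteq> 0"
    using X(1) by auto
  then consider "card (X - M) = 1" | "2 \<le> card (X - M)"
    by linarith
  then show ?thesis
  proof cases
    case 1
    then obtain i where i: "X - M = {i}"
      using card_1_singletonE by blast
    then have "i \<in> X" "M = X - {i}"
      using MF(2) by auto
    moreover have "q ^ (card X - 1) \<le> q\<^sup>2"
      using X(2) q_pos q_less_1 by (intro power_decreasing) auto
    ultimately show ?thesis
      using link_measure_above_minimal_coatom[OF X(1) _ F(1), of i] M(1)
      by (intro has_dominant_linkI[OF X(1) _ F, of i]) auto
  next
    case 2
    obtain i where i: "i \<in> X" "1 - q ^ 3 < link_measure X i (exchange X M F)"
      using dominant by (auto simp: has_dominant_link_def)
    then show ?thesis
      using link_measure_exchange_le[OF X(1) i(1) F(1) MF(1) _ 2] M(2) X(2)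
      by (intro has_dominant_linkI[OF X(1) i(1) F]) (auto simp: gap_width)
  qed
qed

lemma link_measure_shift_target_le:
  assumes X: "finite X" and F: "maximal_intersecting X F" and im: "i \<in> X" "m \<in> X" "i \<noteq> m"
    and low: "link_measure X i F < 1 - q\<^sup>2" "link_measure X m F < 1 - q\<^sup>2"
  shows "link_measure X i (shift m i F) \<le> 1 - q ^ 3"
proof -
  define Y where "Y = X - {i, m}"
  have Y: "finite Y" "Y = X - {m, i}"
    using X by (auto simp: Y_def)
  define u b c where "u = \<mu>\<^sub>p Y (link i (link m F))"
    and "b = \<mu>\<^sub>p Y (link i F)" and "c = \<mu>\<^sub>p Y (link m F)"
  have link_i: "link_measure X i F = p * u + q * b" and link_m: "link_measure X m F = p * u + q * c"
    using link_measure_remove[OF X im(2,3), of F] link_measure_remove[OF X im(1) im(3)[symmetric], of F]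
    unfolding u_def b_def c_def Y_def by (simp_all add: insert_commute link_commute)
  have cross: "A \<inter> B \<noteq> {}" if "A \<subseteq> Y" "B \<subseteq> Y" "A \<in> link i F" "B \<in> link m F" for A B
  proof -
    have "insert i A \<inter> insert m B \<noteq> {}"
      using that maximal_intersecting_meet[OF F, of "insert i A" "insert m B"] by (simp add: link_def)
    then show ?thesis
      using that im(3) by (auto simp: Y_def)
  qed
  have c_le: "c \<le> (1 - b) powr \<eta>"
    unfolding b_def c_def by (rule cross_intersecting_bound[OF Y(1) cross])
  have b_le: "b \<le> (1 - c) powr \<eta>"
    unfolding b_def c_def using cross by (intro cross_intersecting_bound[OF Y(1)]) (metis Int_commute)
  have closed: "upward_closed Y (link k F)" if "k = i \<or> k = m" for k
    using that im upward_closed_link[OF maximal_intersecting_upward_closed[OF F], of k]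
    by (auto simp: upward_closed_def Y_def)
  have range: "u \<le> 1" "0 \<le> b" "0 \<le> c" "b \<le> 1" "c \<le> 1"
    unfolding u_def b_def c_def using biased_measure_le_1 biased_measure_nonneg Y(1) by blast+
  have "link_measure X i (shift m i F) = p * u + q * \<mu>\<^sub>p Y (link i F \<union> link m F)"
    unfolding u_def Y_def by (rule link_measure_shift_target[OF X im(2,3)])
  also have "\<dots> \<le> p * u + q * (b + c - b * c)"
    unfolding b_def c_def using closed q_pos
    by (intro add_left_mono mult_left_mono biased_measure_Un_upward_closed_le Y(1)) auto
  also have "\<dots> \<le> 1 - q ^ 3"
    using union_below_gap[of u c b] union_below_gap[of u b c] range b_le c_le low link_i link_m
    by (cases "c \<le> b") (auto simp: algebra_simps)
  finally show ?thesis .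
qed

lemma has_dominant_link_shiftD:
  assumes X: "finite X" and F: "maximal_intersecting X F" "threshold < \<mu>\<^sub>p X F"
    and im: "i \<in> X" "m \<in> X" "i \<noteq> m" and dominant: "has_dominant_link X (shift m i F)"
  shows "has_dominant_link X F"
proof (rule ccontr)
  assume no: "\<not> has_dominant_link X F"
  have low: "link_measure X k F < 1 - q\<^sup>2" if "k \<in> X" for k
    using has_dominant_linkI[OF X that F] no by (meson not_le)
  obtain k where k: "k \<in> X" "1 - q ^ 3 < link_measure X k (shift m i F)"
    using dominant by (auto simp: has_dominant_link_def)
  moreover have "link_measure X k F \<le> 1 - q ^ 3"
    using low[OF k(1)] gap_endpoints_le by simp
  ultimately have "k = i"
    using link_measure_shift_other[OF X im, of k F] link_measure_shift_source_le[OF X, of m i F]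
    by fastforce
  then show False
    using link_measure_shift_target_le[OF X F(1) im low[OF im(1)] low[OF im(2)]] k(2) by simp
qed

lemma reducible_if_relevant:
  assumes X: "finite X" "4 \<le> card X" "m \<in> X"
    and F: "maximal_intersecting X F" "threshold < \<mu>\<^sub>p X F" and relevant: "\<not> irrelevant X m F"
  obtains G where "maximal_intersecting X G" "\<mu>\<^sub>p X F \<le> \<mu>\<^sub>p X G" "{A \<in> G. m \<in> A} \<subset> {A \<in> F. m \<in> A}"
    "has_dominant_link X G \<Longrightarrow> has_dominant_link X F"
proof -
  consider (shiftable) i A where "i \<in> X" "A \<in> F" "m \<in> A" "i \<notin> A" "transpose i m ` A \<notin> F"
    | (exchangeable) M where "minimal_member F M" "m \<in> M" "card X \<le> 2 * card M"
    using irrelevant_if_irreducible[OF X(3) F(1)] relevant by (meson not_le)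
  then show ?thesis
  proof cases
    case shiftable
    then have im: "i \<in> X" "m \<in> X" "i \<noteq> m"
      using X(3) by auto
    have "B \<in> F" if "B \<in> shift m i F" "m \<in> B" for B
      using that by (cases "i \<in> B") (simp_all add: shift_def)
    moreover have "A \<notin> shift m i F"
      using shiftable by (simp add: shift_def)
    ultimately have "{B \<in> shift m i F. m \<in> B} \<subset> {B \<in> F. m \<in> B}"
      using shiftable by blast
    then show ?thesis
      using that[OF maximal_intersecting_shift[OF F(1) im(1,2)]] has_dominant_link_shiftD[OF X(1) F im]
        biased_measure_shift[OF X(1) im] by simp
  next
    case exchangeable
    then have M: "M \<in> F" "M \<subseteq> X" "M \<noteq> X"
      using maximal_intersecting_subset[OF F(1)] minimal_member_neq_ground[OF F(1)] X(2)
      by (auto simp: minimal_member_def)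
    have "{A \<in> exchange X M F. m \<in> A} \<subset> {A \<in> F. m \<in> A}"
      using M(1) exchangeable(2) by (auto simp: exchange_def)
    then show ?thesis
      using that[OF maximal_intersecting_exchange[OF F(1) exchangeable(1) M(3)]]
        biased_measure_exchange_ge[OF X(1) F(1) M(1) exchangeable(3)]
        has_dominant_link_exchangeD[OF X(1,2) F exchangeable(1,3)] by blast
  qed
qed

lemma has_dominant_link_if_irrelevant:
  assumes X: "finite X" "m \<in> X" and "irrelevant X m F"
    and dominant: "has_dominant_link (X - {m}) (F \<inter> Pow (X - {m}))"
  shows "has_dominant_link X F"
proof -
  obtain i where i: "i \<in> X" "i \<noteq> m" "1 - q ^ 3 < link_measure (X - {m}) i (F \<inter> Pow (X - {m}))"
    using dominant by (auto simp: has_dominant_link_def)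
  have "link_measure (X - {m}) i (F \<inter> Pow (X - {m})) = link_measure (X - {m}) i F"
    unfolding link_measure_def using i by (intro biased_measure_cong) (auto simp: link_def)
  also have "\<dots> = link_measure X i F"
    using link_measure_irrelevant[OF X i(1,2) assms(3)] by simp
  finally show ?thesis
    using i by (auto simp: has_dominant_link_def)
qed

lemma ex_irrelevant:
  assumes X: "finite X" "4 \<le> card X" "m \<in> X" and F: "maximal_intersecting X F" "threshold < \<mu>\<^sub>p X F"
  shows "\<exists>G. maximal_intersecting X G \<and> irrelevant X m G \<and> \<mu>\<^sub>p X F \<le> \<mu>\<^sub>p X G
    \<and> (has_dominant_link X G \<longrightarrow> has_dominant_link X F)"
  using F
proof (induction "card {A \<in> F. m \<in> A}" arbitrary: F rule: less_induct)
  case (less F)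
  show ?case
  proof (cases "irrelevant X m F")
    case True
    then show ?thesis
      using less.prems by blast
  next
    case False
    then obtain G where G: "maximal_intersecting X G" "\<mu>\<^sub>p X F \<le> \<mu>\<^sub>p X G"
      "{A \<in> G. m \<in> A} \<subset> {A \<in> F. m \<in> A}" "has_dominant_link X G \<Longrightarrow> has_dominant_link X F"
      using reducible_if_relevant[OF X less.prems] by blast
    have "finite {A \<in> F. m \<in> A}"
      using less.prems(1) X(1)
      by (auto simp: maximal_intersecting_def intro: finite_subset[of _ "Pow X"])
    then have "card {A \<in> G. m \<in> A} < card {A \<in> F. m \<in> A}"
      using G(3) by (rule psubset_card_mono)
    moreover have "threshold < \<mu>\<^sub>p X G"
      using G(2) less.prems(2) by simp
    ultimately show ?thesis
      using less.hyps[OF _ G(1)] G(2,4) order_trans by blast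
  qed
qed

theorem maximal_intersecting_has_dominant_link:
  assumes "finite X" "maximal_intersecting X F" "threshold < \<mu>\<^sub>p X F"
  shows "has_dominant_link X F"
  using assms
proof (induction "card X" arbitrary: X F rule: less_induct)
  case (less X)
  show ?case
  proof (cases "card X \<le> 3")
    case True
    then show ?thesis
      using singleton_member_if_small has_dominant_link_if_singleton less.prems by metis
  next
    case False
    then obtain m where m: "m \<in> X"
      by (metis all_not_in_conv card.empty zero_le)
    obtain G where G: "maximal_intersecting X G" "irrelevant X m G" "\<mu>\<^sub>p X F \<le> \<mu>\<^sub>p X G"
      "has_dominant_link X G \<Longrightarrow> has_dominant_link X F"
      using ex_irrelevant[OF less.prems(1) _ m less.prems(2,3)] False by auto
    have "\<mu>\<^sub>p X G = \<mu>\<^sub>p (X - {m}) (G \<inter> Pow (X - {m}))"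
      unfolding biased_measure_irrelevant[OF less.prems(1) m G(2)] by (intro biased_measure_cong) auto
    moreover have "card (X - {m}) < card X"
      using less.prems(1) m by (rule card_Diff1_less)
    ultimately have "has_dominant_link (X - {m}) (G \<inter> Pow (X - {m}))"
      using less.hyps less.prems maximal_intersecting_remove_irrelevant[OF G(1) m G(2)] G(3) by simp
    then show ?thesis
      using G(4) has_dominant_link_if_irrelevant[OF less.prems(1) m G(2)] by blast
  qed
qed

end

section \<open>Densities of independent sets\<close>

lemma obtains_two_largest:
  fixes f :: "'a \<Rightarrow> 'b :: linorder"
  assumes "2 \<le> card A"
  obtains k l where "k \<in> A" "l \<in> A - {k}" "\<And>j. j \<in> A \<Longrightarrow> f j \<le> f k" "\<And>j. j \<in> A - {k} \<Longrightarrow> f j \<le> f l"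
proof -
  have A: "finite A" "A \<noteq> {}"
    using assms card.infinite by fastforce+
  obtain k where k: "k \<in> A" "Max (f ` A) = f k"
    using obtains_MAX[OF A] by metis
  have "A - {k} \<noteq> {}"
    using assms card_mono[of "{k}" A] by auto
  then obtain l where l: "l \<in> A - {k}" "Max (f ` (A - {k})) = f l"
    using obtains_MAX[of "A - {k}" f] A(1) by blast
  have "f j \<le> f k" if "j \<in> A" for j
    using that A(1) k(2) Max_ge[of "f ` A" "f j"] by simp
  moreover have "f j \<le> f l" if "j \<in> A - {k}" for j
    using that A(1) l(2) Max_ge[of "f ` (A - {k})" "f j"] by simp
  ultimately show ?thesis
    using that k(1) l(1) by blast
qed

definition agreeing :: "'a set \<Rightarrow> ('a \<Rightarrow> 'b) set \<Rightarrow> ('a \<Rightarrow> 'b) set \<Rightarrow> bool" where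
  "agreeing X A B \<longleftrightarrow> (\<forall>x\<in>A. \<forall>y\<in>B. \<exists>i\<in>X. x i = y i)"

lemma agreeingD: "agreeing X A B \<Longrightarrow> x \<in> A \<Longrightarrow> y \<in> B \<Longrightarrow> \<exists>i\<in>X. x i = y i"
  by (simp add: agreeing_def)

definition ones :: "'a set \<Rightarrow> ('a \<Rightarrow> nat) \<Rightarrow> 'a set" where
  "ones X x = {i \<in> X. x i = 1}"

locale complete_graph_power = skewed_weights p q \<eta> for p q \<eta> +
  fixes t :: nat
  assumes t_ge_3: "3 \<le> t" and t_mult_p: "real t * p = 1"
begin

lemma p_eq: "p = 1 / real t"
  using t_mult_p t_ge_3 by (simp add: field_simps)

lemma p_le: "p \<le> 1 / 3"
  using t_ge_3 by (simp add: p_eq field_simps)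

lemma p_le_q_square: "p \<le> q\<^sup>2"
proof -
  have "p \<le> (2 / 3)\<^sup>2"
    using p_le by (simp add: power2_eq_square)
  also have "\<dots> \<le> q\<^sup>2"
    using p_le by (intro power_mono) (auto simp: q_eq)
  finally show ?thesis .
qed

lemma weighted_average:
  assumes "k \<in> {1..t}"
  shows "p * (\<Sum>j\<in>{1..t}. if j = k then u else v) = p * u + q * v"
proof -
  have "(\<Sum>j\<in>{1..t}. if j = k then u else v) = u + (\<Sum>j\<in>{1..t} - {k}. if j = k then u else v)"
    using assms by (simp add: sum.remove)
  also have "(\<Sum>j\<in>{1..t} - {k}. if j = k then u else v) = (\<Sum>j\<in>{1..t} - {k}. v)"
    by (intro sum.cong) auto
  also have "\<dots> = (real t - 1) * v"
    using assms by (simp add: of_nat_diff)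
  finally have "p * (\<Sum>j\<in>{1..t}. if j = k then u else v) = p * (u + (real t - 1) * v)"
    by simp
  also have "\<dots> = p * u + (real t * p - p) * v"
    by (simp add: algebra_simps)
  finally show ?thesis
    by (simp add: t_mult_p q_eq)
qed

lemma average_le:
  assumes "k \<in> {1..t}" "f k \<le> u" "\<And>j. j \<in> {1..t} \<Longrightarrow> j \<noteq> k \<Longrightarrow> f j \<le> v"
  shows "p * (\<Sum>j\<in>{1..t}. f j) \<le> p * u + q * v"
proof -
  have "(\<Sum>j\<in>{1..t}. f j) \<le> (\<Sum>j\<in>{1..t}. if j = k then u else v)"
    using assms by (intro sum_mono) auto
  then show ?thesis
    using weighted_average[OF assms(1), of u v] p_pos by (metis less_imp_le mult_left_mono)
qed

abbreviation pts :: "'a set \<Rightarrow> ('a \<Rightarrow> nat) set" where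
  "pts X \<equiv> X \<rightarrow>\<^sub>E {1..t}"

lemma finite_points: "finite X \<Longrightarrow> S \<subseteq> pts X \<Longrightarrow> finite S"
  by (meson finite_PiE finite_atLeastAtMost finite_subset)

definition dens :: "'a set \<Rightarrow> ('a \<Rightarrow> nat) set \<Rightarrow> real" where
  "dens X S = real (card S) / real t ^ card X"

definition slice_dens :: "'a set \<Rightarrow> 'a \<Rightarrow> nat \<Rightarrow> ('a \<Rightarrow> nat) set \<Rightarrow> real" where
  "slice_dens X i j S = real (card {x \<in> S. x i = j}) / real t ^ (card X - 1)"

lemma dens_mono: "finite X \<Longrightarrow> B \<subseteq> pts X \<Longrightarrow> A \<subseteq> B \<Longrightarrow> dens X A \<le> dens X B"
  unfolding dens_def by (intro divide_right_mono of_nat_mono card_mono finite_points) auto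

lemma dens_le_1:
  assumes "finite X" "S \<subseteq> pts X"
  shows "dens X S \<le> 1"
proof -
  have "dens X S \<le> dens X (pts X)"
    using assms dens_mono by blast
  also have "\<dots> = 1"
    using assms t_ge_3 by (simp add: dens_def card_PiE)
  finally show ?thesis .
qed

lemma dens_fiber:
  assumes "finite X" "i \<in> X"
  shows "dens X {x \<in> S. x i = j} = p * slice_dens X i j S"
proof -
  have "card X = Suc (card X - 1)"
    using assms card_gt_0_iff[of X] by auto
  then have "real t ^ card X = real t * real t ^ (card X - 1)"
    by (metis power_Suc)
  then show ?thesis
    by (simp add: dens_def slice_dens_def p_eq)
qed

lemma dens_eq_average_slice_dens:
  assumes "finite X" "i \<in> X" "S \<subseteq> pts X"
  shows "dens X S = p * (\<Sum>j\<in>{1..t}. slice_dens X i j S)"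
proof -
  have "finite S"
    using assms by (intro finite_points)
  have "S = (\<Union>j\<in>{1..t}. {x \<in> S. x i = j})"
    using assms(2,3) by (auto simp: PiE_iff)
  moreover have "card (\<Union>j\<in>{1..t}. {x \<in> S. x i = j}) = (\<Sum>j\<in>{1..t}. card {x \<in> S. x i = j})"
    using \<open>finite S\<close> by (intro card_UN_disjoint) auto
  ultimately have "dens X S = (\<Sum>j\<in>{1..t}. dens X {x \<in> S. x i = j})"
    by (simp add: dens_def sum_divide_distrib)
  then show ?thesis
    by (simp add: dens_fiber[OF assms(1,2)] sum_distrib_left)
qed

definition slice :: "'a set \<Rightarrow> 'a \<Rightarrow> nat \<Rightarrow> ('a \<Rightarrow> nat) set \<Rightarrow> ('a \<Rightarrow> nat) set" where
  "slice X i j S = {x \<in> pts X. x(i := j) \<in> S}"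

lemma slice_subset: "slice X i j S \<subseteq> pts X"
  by (auto simp: slice_def)

lemma slice_dens_insert:
  assumes "finite X" "i \<notin> X" "S \<subseteq> pts (insert i X)"
  shows "slice_dens (insert i X) i j S = dens X (slice X i j S)"
proof -
  have extend: "(restrict x X)(i := x i) = x" if "x \<in> S" for x
    using that assms(2,3) by (fastforce simp: PiE_iff extensional_def fun_eq_iff)
  have restrict: "restrict x X \<in> slice X i (x i) S" if "x \<in> S" for x
    using that assms(3) extend[OF that] by (auto simp: slice_def PiE_iff)
  have "bij_betw (\<lambda>x. x(i := j)) (slice X i j S) {x \<in> S. x i = j}"
  proof (rule bij_betw_byWitness[where f' = "\<lambda>x. restrict x X"])
    show "\<forall>x\<in>slice X i j S. restrict (x(i := j)) X = x"
      using assms(2) by (auto simp: slice_def PiE_iff extensional_def fun_eq_iff)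
    show "(\<lambda>x. restrict x X) ` {x \<in> S. x i = j} \<subseteq> slice X i j S"
      using restrict by auto
  qed (use extend in \<open>auto simp: slice_def\<close>)
  then show ?thesis
    using assms(1,2) by (simp add: slice_dens_def dens_def bij_betw_same_card)
qed

lemma slice_dens_eq_dens_slice:
  assumes "finite X" "i \<in> X" "S \<subseteq> pts X"
  shows "slice_dens X i j S = dens (X - {i}) (slice (X - {i}) i j S)"
  using slice_dens_insert[of "X - {i}" i S j] assms by (simp add: insert_absorb)

lemma slice_dens_le_1:
  assumes "finite X" "i \<in> X" "S \<subseteq> pts X"
  shows "slice_dens X i j S \<le> 1"
  using slice_dens_eq_dens_slice[OF assms] dens_le_1[OF _ slice_subset] assms(1) by (metis finite_Diff)

lemma agreeing_slice:
  assumes "agreeing (insert i X) A B" "j \<noteq> k"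
  shows "agreeing X (slice X i j A) (slice X i k B)"
  unfolding agreeing_def
proof (intro ballI)
  fix x y assume "x \<in> slice X i j A" "y \<in> slice X i k B"
  then obtain l where "l \<in> insert i X" "(x(i := j)) l = (y(i := k)) l"
    using agreeingD[OF assms(1)] unfolding slice_def by blast
  then show "\<exists>l\<in>X. x l = y l"
    using assms(2) by (auto split: if_splits)
qed

text \<open>Equality holds when \<open>B\<close> is a subcube \<open>{x. \<forall>i\<in>Y. x i = 1}\<close> and \<open>A\<close> is the set of all points
  agreeing with every point of \<open>B\<close>.\<close>

theorem agreeing_isoperimetry:
  assumes "finite X" "A \<subseteq> pts X" "B \<subseteq> pts X" "agreeing X A B"
  shows "dens X B \<le> (1 - dens X A) powr \<eta>"
  using assms
proof (induction X arbitrary: A B rule: finite_induct)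
  case empty
  then have "A = {} \<or> B = {}"
    by (auto simp: agreeing_def)
  then show ?case
    using dens_le_1[of "{}" B] empty.prems by (auto simp: dens_def)
next
  case (insert i X)
  note cross = insert.prems
  define a b where "a = (\<lambda>j. dens X (slice X i j A))" and "b = (\<lambda>j. dens X (slice X i j B))"
  have IH: "b j \<le> (1 - a k) powr \<eta>" if "k \<noteq> j" for j k
    unfolding a_def b_def using insert.IH slice_subset agreeing_slice[OF cross(3) that] by metis
  have average: "dens (insert i X) A = p * (\<Sum>j\<in>{1..t}. a j)" "dens (insert i X) B = p * (\<Sum>j\<in>{1..t}. b j)"
    using dens_eq_average_slice_dens[of "insert i X" i] insert.hyps cross(1,2)
    by (simp_all add: slice_dens_insert a_def b_def)
  obtain k l where kl: "k \<in> {1..t}" "l \<in> {1..t} - {k}" "\<And>j. j \<in> {1..t} \<Longrightarrow> a j \<le> a k"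
    "\<And>j. j \<in> {1..t} - {k} \<Longrightarrow> a j \<le> a l"
    using obtains_two_largest[of "{1..t}" a] t_ge_3 by auto
  have "a k \<le> 1"
    unfolding a_def using dens_le_1[OF insert.hyps(1) slice_subset] .
  moreover have "dens (insert i X) B \<le> p * (1 - a l) powr \<eta> + q * (1 - a k) powr \<eta>"
    unfolding average using kl IH by (intro average_le[of k]) auto
  moreover have "dens (insert i X) A \<le> p * a k + q * a l"
    unfolding average using kl by (intro average_le[of k]) auto
  ultimately show ?case
    using isoperimetric_step[of "a l" "a k"] kl by simp
qed

definition indep :: "'a set \<Rightarrow> ('a \<Rightarrow> nat) set \<Rightarrow> bool" where
  "indep X S \<longleftrightarrow> S \<subseteq> pts X \<and> agreeing X S S"

lemma indep_subset_pts: "indep X S \<Longrightarrow> S \<subseteq> pts X"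
  by (simp add: indep_def)

lemma indep_finite: "finite X \<Longrightarrow> indep X S \<Longrightarrow> finite S"
  by (simp add: indep_def finite_points)

lemma indep_subset: "indep X T \<Longrightarrow> S \<subseteq> T \<Longrightarrow> indep X S"
  unfolding indep_def agreeing_def by blast

lemma indep_dens_le:
  assumes "finite X" "indep X S"
  shows "dens X S \<le> p"
proof (rule ccontr)
  assume large: "\<not> ?thesis"
  have "dens X S \<le> (1 - dens X S) powr \<eta>"
    using assms by (intro agreeing_isoperimetry) (auto simp: indep_def)
  also have "\<dots> \<le> q powr \<eta>"
    using large dens_le_1[OF assms(1) indep_subset_pts[OF assms(2)]] eta_ge_1
    by (intro powr_mono2) (auto simp: q_eq)
  finally show False
    using large by (simp add: q_powr_eta)
qed

lemma indep_slice_dens_le: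
  assumes "finite X" "i \<in> X" "indep X S" "j \<noteq> k"
  shows "slice_dens X i k S \<le> (1 - slice_dens X i j S) powr \<eta>"
proof -
  have "agreeing (X - {i}) (slice (X - {i}) i j S) (slice (X - {i}) i k S)"
    using agreeing_slice[of i "X - {i}" S S j k] assms by (simp add: indep_def insert_absorb)
  from agreeing_isoperimetry[OF _ slice_subset slice_subset this] show ?thesis
    using assms(1) by (simp add: slice_dens_eq_dens_slice[OF assms(1,2) indep_subset_pts[OF assms(3)]])
qed

lemma indep_dens_le_slice_dens:
  assumes "finite X" "i \<in> X" "indep X S" "j \<in> {1..t}"
  shows "dens X S \<le> p * slice_dens X i j S + q * (1 - slice_dens X i j S) powr \<eta>"
  unfolding dens_eq_average_slice_dens[OF assms(1,2) indep_subset_pts[OF assms(3)]]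
  by (intro average_le[OF assms(4)] indep_slice_dens_le[OF assms(1-3)]) auto

lemma slice_dens_gap:
  assumes "finite X" "i \<in> X" "indep X S" "j \<in> {1..t}" "threshold < dens X S"
  shows "slice_dens X i j S < 1 - q\<^sup>2 \<or> 1 - q ^ 3 < slice_dens X i j S"
  using indep_dens_le_slice_dens[OF assms(1-4)] assms(5) by (intro below_or_above_gap) simp

definition has_dominant_slice :: "'a set \<Rightarrow> ('a \<Rightarrow> nat) set \<Rightarrow> bool" where
  "has_dominant_slice X S \<longleftrightarrow> (\<exists>i\<in>X. \<exists>j\<in>{1..t}. 1 - q ^ 3 < slice_dens X i j S)"

lemma has_dominant_sliceI:
  assumes "finite X" "i \<in> X" "indep X S" "j \<in> {1..t}" "threshold < dens X S"
    and "1 - q\<^sup>2 \<le> slice_dens X i j S"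
  shows "has_dominant_slice X S"
  using slice_dens_gap[OF assms(1-5)] assms(2,4,6) unfolding has_dominant_slice_def by force

end

section \<open>Compression\<close>

definition replace_value :: "'a \<Rightarrow> 'b \<Rightarrow> 'b \<Rightarrow> ('a \<Rightarrow> 'b) set \<Rightarrow> ('a \<Rightarrow> 'b) \<Rightarrow> 'a \<Rightarrow> 'b" where
  "replace_value i a b S x = (if x i = a \<and> x(i := b) \<notin> S then x(i := b) else x)"

lemma inj_on_replace_value: "inj_on (replace_value i a b S) S"
proof (rule inj_onI)
  fix x y assume xy: "x \<in> S" "y \<in> S" "replace_value i a b S x = replace_value i a b S y"
  show "x = y"
  proof (cases "x i = a \<and> x(i := b) \<notin> S \<and> y i = a \<and> y(i := b) \<notin> S")
    case True
    then have "x(i := b) = y(i := b)"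
      using xy by (simp add: replace_value_def)
    then have "x(i := b, i := a) = y(i := b, i := a)"
      by simp
    then show ?thesis
      using True by (simp add: fun_upd_idem)
  next
    case False
    then show ?thesis
      using xy unfolding replace_value_def by (metis (no_types))
  qed
qed

lemma agrees_with_replaced:
  assumes S: "agreeing X S S" and "a \<noteq> b" "i \<in> X" and xy: "x \<in> S" "y \<in> S"
    and replaced: "x i = a" and kept: "y i = a \<Longrightarrow> y(i := b) \<in> S"
  shows "\<exists>k\<in>X. (x(i := b)) k = y k"
proof (cases "y i = b")
  case True
  then show ?thesis
    using assms(3) by auto
next
  case False
  obtain z where z: "z \<in> S" "z i \<noteq> a" "\<And>k. k \<noteq> i \<Longrightarrow> z k = y k"
  proof (cases "y i = a")
    case True
    then show ?thesis
      using that[of "y(i := b)"] kept assms(2) by simp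
  next
    case False
    then show ?thesis
      using that[of y] xy(2) by simp
  qed
  then obtain k where "k \<in> X" "k \<noteq> i" "x k = y k"
    using agreeingD[OF S xy(1) z(1)] replaced by metis
  then show ?thesis
    by auto
qed

lemma agreeing_replace_value:
  assumes S: "agreeing X S S" and i: "i \<in> X" and "a \<noteq> b"
  shows "agreeing X (replace_value i a b S ` S) (replace_value i a b S ` S)"
proof -
  let ?r = "replace_value i a b S"
  have "\<exists>k\<in>X. ?r x k = ?r y k" if xy: "x \<in> S" "y \<in> S" for x y
  proof (cases "x i = a \<and> x(i := b) \<notin> S"; cases "y i = a \<and> y(i := b) \<notin> S")
    assume "x i = a \<and> x(i := b) \<notin> S" "y i = a \<and> y(i := b) \<notin> S"
    then show ?thesis
      using i by (auto simp: replace_value_def)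
  next
    assume moved: "x i = a \<and> x(i := b) \<notin> S" "\<not> (y i = a \<and> y(i := b) \<notin> S)"
    then have "?r x = x(i := b)" "?r y = y"
      unfolding replace_value_def by auto
    then show ?thesis
      using agrees_with_replaced[OF S assms(3) i xy] moved by simp
  next
    assume moved: "\<not> (x i = a \<and> x(i := b) \<notin> S)" "y i = a \<and> y(i := b) \<notin> S"
    then have "?r x = x" "?r y = y(i := b)"
      unfolding replace_value_def by auto
    moreover have "\<exists>k\<in>X. (y(i := b)) k = x k"
      using agrees_with_replaced[OF S assms(3) i xy(2,1)] moved by blast
    ultimately show ?thesis
      by metis
  next
    assume "\<not> (x i = a \<and> x(i := b) \<notin> S)" "\<not> (y i = a \<and> y(i := b) \<notin> S)"
    then have "?r x = x" "?r y = y"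
      unfolding replace_value_def by auto
    then show ?thesis
      using agreeingD[OF S xy] by simp
  qed
  then show ?thesis
    by (simp add: agreeing_def)
qed

lemma sum_replace_value_less:
  fixes S :: "('a \<Rightarrow> nat) set"
  assumes fin: "finite S" "finite X" and "b < a" and x: "x \<in> S" "x i = a" "x(i := b) \<notin> S" "i \<in> X"
  shows "(\<Sum>y\<in>replace_value i a b S ` S. \<Sum>k\<in>X. y k) < (\<Sum>y\<in>S. \<Sum>k\<in>X. y k)"
proof -
  let ?r = "replace_value i a b S"
  have le: "(\<Sum>k\<in>X. ?r y k) \<le> (\<Sum>k\<in>X. y k)" for y
    using assms(3) by (intro sum_mono) (auto simp: replace_value_def)
  have less: "(\<Sum>k\<in>X. ?r x k) < (\<Sum>k\<in>X. x k)"
    using assms by (intro sum_strict_mono_ex1) (auto simp: replace_value_def)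
  have "(\<Sum>y\<in>?r ` S. \<Sum>k\<in>X. y k) = (\<Sum>y\<in>S. \<Sum>k\<in>X. ?r y k)"
    by (simp add: sum.reindex inj_on_replace_value)
  also have "\<dots> < (\<Sum>y\<in>S. \<Sum>k\<in>X. y k)"
    using fin(1) x(1) le less by (intro sum_strict_mono_ex1) auto
  finally show ?thesis .
qed

definition compressed :: "'a set \<Rightarrow> ('a \<Rightarrow> nat) set \<Rightarrow> bool" where
  "compressed X S \<longleftrightarrow> (\<forall>x\<in>S. \<forall>i\<in>X. x(i := 1) \<in> S)"

lemma override_on_one_compressed:
  assumes "compressed X S" "x \<in> S" "finite Z" "Z \<subseteq> X"
  shows "override_on x (\<lambda>_. 1) Z \<in> S"
  using assms(3,4)
proof (induction Z rule: finite_induct)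
  case empty
  then show ?case
    using assms(2) by simp
next
  case (insert i Z)
  then have "(override_on x (\<lambda>_. 1) Z)(i := 1) \<in> S"
    using assms(1) unfolding compressed_def by blast
  then show ?case
    by (simp only: override_on_insert)
qed

lemma compressed_ones_meet:
  assumes "finite X" "agreeing X S S" "compressed X S" and xy: "x \<in> S" "y \<in> S"
  shows "ones X x \<inter> ones X y \<noteq> {}"
proof -
  define Z where "Z = {i \<in> X. x i = y i \<and> x i \<noteq> 1}"
  have "override_on x (\<lambda>_. 1) Z \<in> S"
    using assms(1) xy(1) by (intro override_on_one_compressed[OF assms(3)]) (auto simp: Z_def)
  then obtain k where k: "k \<in> X" "override_on x (\<lambda>_. 1) Z k = y k"
    using agreeingD[OF assms(2) _ xy(2)] by blast
  then have "k \<notin> Z"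
    by (auto simp: Z_def override_on_def split: if_splits)
  then have "k \<in> ones X x \<inter> ones X y"
    using k by (auto simp: Z_def ones_def)
  then show ?thesis
    by blast
qed

context complete_graph_power
begin

lemma indep_replace_value:
  assumes "indep X S" "i \<in> X" "a \<noteq> b" "b \<in> {1..t}"
  shows "indep X (replace_value i a b S ` S)"
  using assms agreeing_replace_value[of X S i a b] unfolding indep_def
  by (auto simp: replace_value_def PiE_iff extensional_def)

lemma dens_replace_value: "dens X (replace_value i a b S ` S) = dens X S"
  by (simp add: dens_def card_image inj_on_replace_value)

lemma slice_dens_replace_value_other:
  assumes "k \<noteq> i"
  shows "slice_dens X k l (replace_value i a b S ` S) = slice_dens X k l S"
proof -
  have "{x \<in> replace_value i a b S ` S. x k = l} = replace_value i a b S ` {x \<in> S. x k = l}"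
    using assms by (auto simp: replace_value_def)
  then show ?thesis
    by (simp add: slice_dens_def card_image inj_on_subset[OF inj_on_replace_value])
qed

lemma slice_dens_replace_value_le:
  assumes "finite S" "l \<noteq> b"
  shows "slice_dens X i l (replace_value i a b S ` S) \<le> slice_dens X i l S"
proof -
  have "{x \<in> replace_value i a b S ` S. x i = l} \<subseteq> {x \<in> S. x i = l}"
    using assms by (auto simp: replace_value_def)
  then show ?thesis
    using assms unfolding slice_dens_def by (intro divide_right_mono of_nat_mono card_mono) auto
qed

lemma slice_dens_replace_value_target_le:
  assumes "finite S"
  shows "slice_dens X i b (replace_value i a b S ` S) \<le> slice_dens X i b S + slice_dens X i a S"
proof -
  let ?r = "replace_value i a b S" and ?T = "{x \<in> S. x i = b} \<union> {x \<in> S. x i = a}"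
  have "card {x \<in> ?r ` S. x i = b} \<le> card (?r ` ?T)"
    using assms by (intro card_mono) (auto simp: replace_value_def)
  also have "\<dots> \<le> card ?T"
    using assms by (intro card_image_le) auto
  also have "\<dots> \<le> card {x \<in> S. x i = b} + card {x \<in> S. x i = a}"
    by (rule card_Un_le)
  finally show ?thesis
    unfolding slice_dens_def add_divide_distrib[symmetric]
    by (intro divide_right_mono) (auto simp flip: of_nat_add)
qed

lemma has_dominant_slice_replace_valueD:
  assumes X: "finite X" and S: "indep X S" "threshold < dens X S" and i: "i \<in> X"
    and ab: "a \<noteq> b" "a \<in> {1..t}" "b \<in> {1..t}"
    and dominant: "has_dominant_slice X (replace_value i a b S ` S)"
  shows "has_dominant_slice X S"
proof (rule ccontr)
  assume no: "\<not> has_dominant_slice X S"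
  have low: "slice_dens X k l S < 1 - q\<^sup>2" if "k \<in> X" "l \<in> {1..t}" for k l
    using has_dominant_sliceI[OF X that(1) S(1) that(2) S(2)] no by (meson not_le)
  obtain k l where kl: "k \<in> X" "l \<in> {1..t}" "1 - q ^ 3 < slice_dens X k l (replace_value i a b S ` S)"
    using dominant by (auto simp: has_dominant_slice_def)
  moreover have "slice_dens X k l S \<le> 1 - q ^ 3"
    using low[OF kl(1,2)] gap_endpoints_le by simp
  ultimately have "k = i" "l = b"
    using slice_dens_replace_value_other[of k i X l a b S]
      slice_dens_replace_value_le[OF indep_finite[OF X S(1)], of l b X i a] by fastforce+
  then have "1 - q ^ 3 < slice_dens X i b S + slice_dens X i a S"
    using kl(3) slice_dens_replace_value_target_le[OF indep_finite[OF X S(1)], of X i b a] by simp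
  moreover have "slice_dens X i c S + slice_dens X i d S \<le> 1 - q ^ 3"
    if "slice_dens X i d S \<le> slice_dens X i c S" "c \<noteq> d" "c \<in> {1..t}" for c d
    using sum_of_two_densities_below_gap[OF p_le_q_square that(1)] low[OF i that(3)]
      indep_slice_dens_le[OF X i S(1) that(2)] by simp
  ultimately show False
    using ab by (metis add.commute linear not_le)
qed

lemma ex_compressed:
  assumes X: "finite X" and S: "indep X S" "threshold < dens X S"
  shows "\<exists>T. indep X T \<and> compressed X T \<and> dens X T = dens X S
    \<and> (has_dominant_slice X T \<longrightarrow> has_dominant_slice X S)"
  using S
proof (induction "\<Sum>x\<in>S. \<Sum>i\<in>X. x i" arbitrary: S rule: less_induct)
  case less
  show ?case
  proof (cases "compressed X S")
    case True
    then show ?thesis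
      using less.prems by blast
  next
    case False
    then obtain x i where x: "x \<in> S" "i \<in> X" "x(i := 1) \<notin> S"
      by (auto simp: compressed_def)
    have i: "x i \<noteq> 1" "x i \<in> {1..t}" "1 \<in> {1..t}"
      using x indep_subset_pts[OF less.prems(1)] t_ge_3 by (auto simp: PiE_iff fun_upd_idem)
    then have "1 < x i"
      by simp
    define T where "T = replace_value i (x i) 1 S ` S"
    have T: "indep X T" "dens X T = dens X S"
      unfolding T_def using less.prems(1) x(2) i
      by (auto simp: dens_replace_value intro: indep_replace_value)
    have "(\<Sum>y\<in>T. \<Sum>k\<in>X. y k) < (\<Sum>y\<in>S. \<Sum>k\<in>X. y k)"
      unfolding T_def using x \<open>1 < x i\<close> X indep_finite[OF X less.prems(1)]
      by (intro sum_replace_value_less) auto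
    moreover have "has_dominant_slice X T \<longrightarrow> has_dominant_slice X S"
      unfolding T_def using has_dominant_slice_replace_valueD[OF X less.prems x(2) i] by blast
    ultimately show ?thesis
      using less.hyps[OF _ T(1)] T(2) less.prems(2) by metis
  qed
qed

lemma slice_dens_insert_le:
  assumes "finite S"
  shows "slice_dens X i j (insert z S) \<le> slice_dens X i j S + p ^ (card X - 1)"
proof -
  have "card {x \<in> insert z S. x i = j} \<le> card (insert z {x \<in> S. x i = j})"
    using assms by (intro card_mono) auto
  also have "\<dots> \<le> card {x \<in> S. x i = j} + 1"
    by (simp add: assms card_insert_if)
  finally have "slice_dens X i j (insert z S) \<le> slice_dens X i j S + 1 / real t ^ (card X - 1)"
    unfolding slice_dens_def add_divide_distrib[symmetric]
    by (intro divide_right_mono) (auto simp flip: of_nat_Suc)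
  then show ?thesis
    by (simp add: p_eq power_divide)
qed

lemma has_dominant_slice_insertD:
  assumes X: "finite X" "3 \<le> card X" and S: "indep X S" "threshold < dens X S"
    and dominant: "has_dominant_slice X (insert z S)"
  shows "has_dominant_slice X S"
proof -
  obtain i j where ij: "i \<in> X" "j \<in> {1..t}" "1 - q ^ 3 < slice_dens X i j (insert z S)"
    using dominant by (auto simp: has_dominant_slice_def)
  have "p ^ (card X - 1) \<le> p\<^sup>2"
    using X(2) p_pos p_le by (intro power_decreasing) auto
  also have "\<dots> \<le> p * q\<^sup>2"
    using p_le_q_square p_pos by (simp add: power2_eq_square)
  finally have "1 - q\<^sup>2 \<le> slice_dens X i j S"
    using ij(3) slice_dens_insert_le[OF indep_finite[OF X(1) S(1)], of X i j z] by (simp add: gap_width)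
  then show ?thesis
    using has_dominant_sliceI[OF X(1) ij(1) S(1) ij(2) S(2)] by blast
qed

lemma has_dominant_slice_UnD:
  assumes X: "finite X" "3 \<le> card X" and "finite D"
    and "indep X (S \<union> D)" "threshold < dens X S" "has_dominant_slice X (S \<union> D)"
  shows "has_dominant_slice X S"
  using assms(3-6)
proof (induction D arbitrary: S rule: finite_induct)
  case empty
  then show ?case
    by simp
next
  case (insert z D)
  have ind: "indep X S" "indep X (insert z S)"
    using insert.prems(1) indep_subset by blast+
  have "dens X S \<le> dens X (insert z S)"
    using ind(2) X(1) by (intro dens_mono indep_subset_pts) auto
  then have "has_dominant_slice X (insert z S)"
    using insert.IH[of "insert z S"] insert.prems by simp
  then show ?case
    using has_dominant_slice_insertD[OF X ind(1) insert.prems(2)] by blast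
qed

section \<open>Stability\<close>

definition ones_preimage :: "'a set \<Rightarrow> 'a set set \<Rightarrow> ('a \<Rightarrow> nat) set" where
  "ones_preimage X F = {x \<in> pts X. ones X x \<in> F}"

lemma slice_ones_preimage:
  assumes "i \<notin> X" "j \<in> {1..t}"
  shows "slice X i j (ones_preimage (insert i X) F) = ones_preimage X (if j = 1 then link i F else F)"
proof -
  have "ones (insert i X) (x(i := j)) = (if j = 1 then insert i (ones X x) else ones X x)" for x
    using assms(1) by (auto simp: ones_def)
  moreover have "x(i := j) \<in> pts (insert i X)" if "x \<in> pts X" for x
    using that assms(2) by (auto simp: PiE_iff extensional_def)
  ultimately show ?thesis
    unfolding slice_def ones_preimage_def by (auto simp: link_def)
qed

lemma dens_ones_preimage: "finite X \<Longrightarrow> dens X (ones_preimage X F) = \<mu>\<^sub>p X F"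
proof (induction X arbitrary: F rule: finite_induct)
  case empty
  then show ?case
    by (simp add: dens_def ones_preimage_def ones_def biased_measure_empty)
next
  case (insert i X)
  have sub: "ones_preimage (insert i X) F \<subseteq> pts (insert i X)"
    by (auto simp: ones_preimage_def)
  have "slice_dens (insert i X) i j (ones_preimage (insert i X) F)
      = (if j = 1 then \<mu>\<^sub>p X (link i F) else \<mu>\<^sub>p X F)" if "j \<in> {1..t}" for j
    using insert that by (simp add: slice_dens_insert[OF insert.hyps sub] slice_ones_preimage)
  then have "(\<Sum>j\<in>{1..t}. slice_dens (insert i X) i j (ones_preimage (insert i X) F))
      = (\<Sum>j\<in>{1..t}. if j = 1 then \<mu>\<^sub>p X (link i F) else \<mu>\<^sub>p X F)"
    by (rule sum.cong[OF refl])
  then have "dens (insert i X) (ones_preimage (insert i X) F)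
      = p * (\<Sum>j\<in>{1..t}. if j = 1 then \<mu>\<^sub>p X (link i F) else \<mu>\<^sub>p X F)"
    using dens_eq_average_slice_dens[OF _ insertI1 sub] insert.hyps(1) by simp
  also have "\<dots> = \<mu>\<^sub>p (insert i X) F"
    using t_ge_3 insert.hyps by (subst weighted_average) (auto simp: biased_measure_insert)
  finally show ?case .
qed

lemma slice_dens_ones_preimage:
  assumes "finite X" "i \<in> X"
  shows "slice_dens X i 1 (ones_preimage X F) = link_measure X i F"
proof -
  have "slice (X - {i}) i 1 (ones_preimage X F) = ones_preimage (X - {i}) (link i F)"
    using slice_ones_preimage[of i "X - {i}" 1 F] assms t_ge_3 by (simp add: insert_absorb)
  moreover have "ones_preimage X F \<subseteq> pts X"
    by (auto simp: ones_preimage_def)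
  ultimately show ?thesis
    using slice_dens_eq_dens_slice[OF assms, of "ones_preimage X F" 1] assms(1)
    by (simp add: dens_ones_preimage link_measure_def)
qed

lemma indep_ones_preimage:
  assumes "maximal_intersecting X F"
  shows "indep X (ones_preimage X F)"
proof -
  have "\<exists>i\<in>X. x i = y i" if "x \<in> ones_preimage X F" "y \<in> ones_preimage X F" for x y
  proof -
    have "ones X x \<inter> ones X y \<noteq> {}"
      using that by (intro maximal_intersecting_meet[OF assms]) (auto simp: ones_preimage_def)
    then obtain i where "i \<in> X" "x i = 1" "y i = 1"
      by (auto simp: ones_def)
    then show ?thesis
      by (intro bexI[of _ i]) auto
  qed
  then show ?thesis
    by (auto simp: indep_def agreeing_def ones_preimage_def)
qed

lemma compressed_subset_ones_preimage:
  assumes X: "finite X" "X \<noteq> {}" and S: "indep X S" "compressed X S"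
  obtains F where "maximal_intersecting X F" "S \<subseteq> ones_preimage X F"
proof -
  have "A \<inter> B \<noteq> {}" if "A \<in> ones X ` S" "B \<in> ones X ` S" for A B
    using that compressed_ones_meet[OF X(1) _ S(2)] S(1) by (auto simp: indep_def)
  moreover have "ones X ` S \<subseteq> Pow X"
    by (auto simp: ones_def)
  ultimately obtain F where "maximal_intersecting X F" "ones X ` S \<subseteq> F"
    using extend_to_maximal_intersecting[OF X] by metis
  then show ?thesis
    using that[of F] indep_subset_pts[OF S(1)] by (auto simp: ones_preimage_def)
qed

lemma has_dominant_slice_if_constant:
  assumes X: "finite X" "i \<in> X" and S: "indep X S" "threshold < dens X S"
    and j: "j \<in> {1..t}" "\<And>x. x \<in> S \<Longrightarrow> x i = j"
  shows "has_dominant_slice X S"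
proof -
  have "{x \<in> S. x i = j} = S"
    using j(2) by blast
  then have "p * (1 - q * (q - p)) < p * slice_dens X i j S"
    using S(2) dens_fiber[OF X, of S j] by (simp add: threshold_eq)
  then have "1 - q * (q - p) < slice_dens X i j S"
    using p_pos by simp
  moreover have "q * (q - p) \<le> q\<^sup>2"
    using p_pos q_pos by (simp add: power2_eq_square)
  ultimately show ?thesis
    using has_dominant_sliceI[OF X S(1) j(1) S(2)] by simp
qed

lemma compressed_has_dominant_slice:
  assumes X: "finite X" "X \<noteq> {}" and S: "indep X S" "threshold < dens X S" "compressed X S"
  shows "has_dominant_slice X S"
proof -
  obtain F where F: "maximal_intersecting X F" and sub: "S \<subseteq> ones_preimage X F"
    using compressed_subset_ones_preimage[OF X S(1,3)] by blast
  have one: "1 \<in> {1..t}"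
    using t_ge_3 by simp
  have "dens X S \<le> dens X (ones_preimage X F)"
    using sub X(1) by (intro dens_mono) (auto simp: ones_preimage_def)
  then have large: "threshold < \<mu>\<^sub>p X F"
    using S(2) X(1) by (simp add: dens_ones_preimage)
  show ?thesis
  proof (cases "card X \<le> 3")
    case True
    then obtain i where i: "i \<in> X" "{i} \<in> F"
      using singleton_member_if_small[OF X(1) _ F large] by blast
    have "x i = 1" if "x \<in> S" for x
      using that sub maximal_intersecting_meet[OF F i(2), of "ones X x"]
      by (auto simp: ones_preimage_def ones_def)
    then show ?thesis
      using has_dominant_slice_if_constant[OF X(1) i(1) S(1,2) one] by blast
  next
    case False
    obtain i where "i \<in> X" "1 - q ^ 3 < link_measure X i F"
      using maximal_intersecting_has_dominant_link[OF X(1) F large] by (auto simp: has_dominant_link_def)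
    then have "has_dominant_slice X (ones_preimage X F)"
      using one slice_dens_ones_preimage[OF X(1)] unfolding has_dominant_slice_def by metis
    moreover have "S \<union> ones_preimage X F = ones_preimage X F"
      using sub by blast
    ultimately show ?thesis
      using has_dominant_slice_UnD[OF X(1) _ _ _ S(2), of "ones_preimage X F"] False
        indep_ones_preimage[OF F] indep_finite[OF X(1)] by simp
  qed
qed

lemma large_indep_has_dominant_slice:
  assumes "finite X" "X \<noteq> {}" "indep X S" "threshold < dens X S"
  shows "has_dominant_slice X S"
  using ex_compressed[OF assms(1,3,4)] compressed_has_dominant_slice[OF assms(1,2)] assms(4) by metis

definition dictator :: "'a set \<Rightarrow> 'a \<Rightarrow> nat \<Rightarrow> ('a \<Rightarrow> nat) set" where
  "dictator X i j = {x \<in> pts X. x i = j}"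

lemma indep_dictator: "i \<in> X \<Longrightarrow> indep X (dictator X i j)"
  by (auto simp: dictator_def indep_def agreeing_def intro!: bexI[of _ i])

lemma dens_dictator:
  assumes "finite X" "i \<in> X" "j \<in> {1..t}"
  shows "dens X (dictator X i j) = p"
proof -
  have "x(i := j) \<in> pts X" if "x \<in> pts (X - {i})" for x
    using PiE_fun_upd[OF assms(3) that, of i] assms(2) by (simp add: insert_absorb)
  then have "slice (X - {i}) i j (pts X) = pts (X - {i})"
    unfolding slice_def by blast
  moreover have "dens (X - {i}) (pts (X - {i})) = 1"
    using assms(1) t_ge_3 by (simp add: dens_def card_PiE)
  ultimately show ?thesis
    unfolding dictator_def dens_fiber[OF assms(1,2)]
    using slice_dens_eq_dens_slice[OF assms(1,2), of "pts X" j] by simp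
qed

lemma card_indep_le_card_dictator:
  assumes "finite X" "i \<in> X" "j \<in> {1..t}" "indep X S"
  shows "card S \<le> card (dictator X i j)"
proof -
  have "dens X S \<le> dens X (dictator X i j)"
    using indep_dens_le assms by (simp add: dens_dictator)
  then show ?thesis
    using t_ge_3 by (simp add: dens_def divide_le_cancel)
qed

lemma dens_outside_dictator_le:
  assumes X: "finite X" "i \<in> X" and S: "indep X S" and j: "j \<in> {1..t}"
    and dominant: "1 - q ^ 3 < slice_dens X i j S"
  shows "dens X (S - dictator X i j) \<le> 4 * (1 - dens X S / p) powr \<eta>"
proof -
  define v where "v = 1 - slice_dens X i j S"
  have v: "0 \<le> v" "v \<le> q ^ 3"
    using dominant slice_dens_le_1[OF X indep_subset_pts[OF S]] by (auto simp: v_def)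
  have dens: "dens X S \<le> p * (1 - v) + q * v powr \<eta>"
    using indep_dens_le_slice_dens[OF X S j] by (simp add: v_def)
  have "S - dictator X i j = S - {x \<in> S. x i = j}"
    using indep_subset_pts[OF S] by (auto simp: dictator_def)
  then have "dens X (S - dictator X i j) = dens X S - p * (1 - v)"
    using indep_finite[OF X(1) S] dens_fiber[OF X, of S j]
    by (simp add: v_def dens_def card_Diff_subset card_mono of_nat_diff diff_divide_distrib)
  also have "\<dots> \<le> 1 * v powr \<eta>"
    using dens q_less_1 mult_right_mono[of q 1 "v powr \<eta>"] by simp
  also have "\<dots> \<le> 4 * (1 - dens X S / p) powr \<eta>"
    using powr_eta_le_deficit_powr_eta[OF p_le v dens] by simp
  finally show ?thesis .
qed

theorem large_indep_near_dictator:
  assumes "finite X" "X \<noteq> {}" "indep X S" "threshold < dens X S"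
  obtains i j where "i \<in> X" "j \<in> {1..t}"
    "dens X (S - dictator X i j) \<le> 4 * (1 - dens X S / p) powr \<eta>"
  using large_indep_has_dominant_slice[OF assms] dens_outside_dictator_le[OF assms(1) _ assms(3)]
  unfolding has_dominant_slice_def by blast

lemma mu_eq_dens: "mu t n S = dens {1..n} S"
  by (simp add: mu_def dens_def)

lemma K_indep_iff_indep: "K_indep t n S \<longleftrightarrow> indep {1..n} S"
  unfolding K_indep_def K_adj_def indep_def agreeing_def cube_def by blast

lemma K_max_indep_dictator:
  assumes "i \<in> {1..n}" "j \<in> {1..t}"
  shows "K_max_indep t n (dictator {1..n} i j)"
  unfolding K_max_indep_def K_indep_iff_indep
  using indep_dictator[OF assms(1)] card_indep_le_card_dictator[OF _ assms] by simp

end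

lemma one_minus_inverse_powr_eta:
  assumes "2 \<le> t"
  shows "(1 - 1 / real t) powr eta t = 1 / real t"
proof -
  define d where "d = ln (real t) - ln (real t - 1)"
  have "1 - 1 / real t = (real t - 1) / real t"
    using assms by (simp add: field_simps)
  then have "ln (1 - 1 / real t) = - d"
    using assms by (simp add: ln_div d_def)
  moreover have "0 < d"
    using assms by (simp add: d_def)
  ultimately have "eta t * ln (1 - 1 / real t) = - ln (real t)"
    by (simp add: eta_def flip: d_def)
  moreover have "0 < 1 - 1 / real t"
    using assms by simp
  ultimately show ?thesis
    using assms by (simp add: powr_def exp_minus inverse_eq_divide)
qed

lemma complete_graph_power_eta:
  assumes "3 \<le> t"
  shows "complete_graph_power (1 / real t) (1 - 1 / real t) (eta t) t"
  using assms one_minus_inverse_powr_eta[of t] by unfold_locales (auto simp: field_simps)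

theorem theorem1p5:
  fixes t n :: nat and I :: "(nat \<Rightarrow> nat) set" and \<epsilon> :: real
  assumes "t \<ge> 3" and "n \<ge> 1"
    and "K_indep t n I"
    and "\<epsilon> = 1 - real t * mu t n I"
    and "\<epsilon> < 1 - 3 / real t + 2 / (real t)\<^sup>2"
  shows "\<exists>J. K_max_indep t n J \<and> mu t n J = 1 / real t
           \<and> mu t n (I - J) \<le> 4 * \<epsilon> powr eta t"
proof -
  interpret complete_graph_power "1 / real t" "1 - 1 / real t" "eta t" t
    using assms(1) by (rule complete_graph_power_eta)
  have "real t * threshold = 3 / real t - 2 / (real t)\<^sup>2"
    using assms(1) by (simp add: threshold_def field_simps power2_eq_square power3_eq_cube)
  then have "real t * threshold < real t * dens {1..n} I"
    using assms(4,5) by (simp add: mu_eq_dens)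
  then have "threshold < dens {1..n} I"
    using assms(1) by simp
  then obtain i j where ij: "i \<in> {1..n}" "j \<in> {1..t}"
    and near: "dens {1..n} (I - dictator {1..n} i j) \<le> 4 * (1 - dens {1..n} I / (1 / real t)) powr eta t"
    using large_indep_near_dictator[of "{1..n}" I] assms(2,3) by (auto simp: K_indep_iff_indep)
  have "mu t n (dictator {1..n} i j) = 1 / real t"
    using dens_dictator[of "{1..n}" i j] ij by (simp add: mu_eq_dens)
  moreover have "mu t n (I - dictator {1..n} i j) \<le> 4 * \<epsilon> powr eta t"
    using near by (simp add: assms(4) mu_eq_dens mult.commute)
  ultimately show ?thesis
    using K_max_indep_dictator[OF ij] by blast
qed

end
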